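(* Let $\bm\mu=(\mu_1,\dots,\mu_r)$ be either an Angelesco system on the unit circle or an AT system on the unit circle (both defined in the context, together with the corresponding choice of square-root branch). Then for every multi-index $\bm n\in\mathbb N^r$, the polynomial $z^{|\bm n|/2}\phi_{\bm n}(z)$ (which has degree $|\bm n|$) has all of its $|\bm n|$ zeros, counted with multiplicity, in the open unit disc $\mathbb D=\{z:|z|<1\}$.
   Context: Let $\partial\mathbb D=\{z\in\mathbb C:|z|=1\}$. All measures are finite positive Borel measures on $\partial\mathbb D$ with infinite support. For a fixed $t_0\in\mathbb R$ define the branch $z^{k/2}=|z|^{k/2}\exp\big(ik\arg_{[t_0,t_0+2\pi)}(z)/2\big)$, $k\in\mathbb Z$, where $\arg_{[t_0,t_0+2\pi)}$ takes values in $[t_0,t_0+2\pi)$. For $\bm n=(n_1,\dots,n_r)\in\mathbb N^r$ (non-negative integers) let $|\bm n|=n_1+\dots+n_r$; $\operatorname{span}\{z^p\}_{p=a}^{b}$ (with $b-a\in\mathbb Z$, $a,b$ integers or half-integers) denotes the span of $z^a,z^{a+1},\dots,z^b$. The index $\bm n$ is called $\phi$-normal if there is a unique $\phi_{\bm n}\in\operatorname{span}\{z^p\}_{p=-|\bm n|/2}^{|\bm n|/2}$ of the form $\phi_{\bm n}(z)=z^{|\bm n|/2}+\kappa_{|\bm n|/2-1}z^{|\bm n|/2-1}+\dots+\kappa_{-|\bm n|/2}z^{-|\bm n|/2}$ with $\int\phi_{\bm n}(z)z^{-p}\,d\mu_j(z)=0$ for $p=-n_j/2,-n_j/2+1,\dots,n_j/2-1$,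 $j=1,\dots,r$. Angelesco system: there are closed arcs $\Gamma_j\subset\partial\mathbb D$ with $\operatorname{supp}\mu_j\subseteq\Gamma_j$, $\Gamma_j\cap\Gamma_k$ contained in the set of endpoints of the arcs for $j\ne k$; $t_0$ and the ordering of the arcs are chosen so that $t_0\le\theta_1\le\dots\le\theta_r\le t_0+2\pi$ whenever $e^{i\theta_k}\in\Gamma_k$ ($\theta_k\in[t_0,t_0+2\pi]$), the branch above uses this $t_0$, and $\mu_r$ has no point mass at $e^{it_0}$. AT system: $d\mu_j(e^{i\theta})=w_j(\theta)\,d\mu(e^{i\theta})$, $j=1,\dots,r$, with $w_j$ continuous real-valued on $[\alpha,\beta]$ and $\mu$ a measure supported on the arc $\Gamma=\{e^{i\theta}:\alpha\le\theta\le\beta\}$, $0<\beta-\alpha\le2\pi$. For a function $f$ let $\operatorname{Trig}_m(f)=\{f(\theta)\cos\frac{2k-1}{2}\theta,\ f(\theta)\sin\frac{2k-1}{2}\theta\}_{k=1}^{m/2}$ if $m$ is even and $\operatorname{Trig}_m(f)=\{f(\theta)\}\cup\{f(\theta)\cos k\theta,\ f(\theta)\sin k\theta\}_{k=1}^{(m-1)/2}$ if $m$ is odd. $\bm\mu$ is an AT system on $\Gamma$ if for every multi-index $\bm n$ the family $\bigcup_{j=1}^r\operatorname{Trig}_{n_j}(w_j)$ is a Chebyshev system on $[\alpha,\beta]$, i.e. for these $N$ functions $u_1,\dots,u_N$ one has $\det(u_i(x_k))_{i,k=1}^N\neq0$ for all distinct $x_1,\dots,x_N\in[\alpha,\beta]$.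 For AT systems the branch uses $t_0=\alpha$. It is known (from earlier work) that for Angelesco and AT systems every $\bm n\in\mathbb N^r$ is $\phi$-normal, so $\phi_{\bm n}$ is well defined. *)

theory Defs
  imports "HOL-Analysis.Analysis"
begin

definition arg_from :: "real \<Rightarrow> complex \<Rightarrow> real" where
  "arg_from t0 z = t0 + 2 * pi * frac ((Arg z - t0) / (2 * pi))"

definition hpow :: "real \<Rightarrow> int \<Rightarrow> complex \<Rightarrow> complex" where
  "hpow t0 k z = complex_of_real (cmod z powr (real_of_int k / 2))
                 * cis (real_of_int k * arg_from t0 z / 2)"

definition msupp :: "complex measure \<Rightarrow> complex set" where
  "msupp M = {z. \<forall>e>0. emeasure M (ball z e) \<noteq> 0}"

definition circle_measure :: "complex measure \<Rightarrow> bool" where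
  "circle_measure M \<longleftrightarrow> sets M = sets borel \<and> finite_measure M
     \<and> emeasure M (- sphere 0 1) = 0 \<and> infinite (msupp M)"

definition arc :: "real \<Rightarrow> real \<Rightarrow> complex set" where
  "arc a b = cis ` {a..b}"

definition angelesco :: "real \<Rightarrow> nat \<Rightarrow> (nat \<Rightarrow> complex measure) \<Rightarrow> bool" where
  "angelesco t0 r \<mu> \<longleftrightarrow>
     (\<exists>a b :: nat \<Rightarrow> real.
        (\<forall>k<r. a k \<le> b k \<and> msupp (\<mu> k) \<subseteq> arc (a k) (b k)) \<and>
        (\<forall>j<r. \<forall>k<r. j \<noteq> k \<longrightarrow>
            arc (a j) (b j) \<inter> arc (a k) (b k) \<subseteq> {cis (a j), cis (b j), cis (a k), cis (b k)}) \<and>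
        (0 < r \<longrightarrow> t0 \<le> a 0 \<and> b (r - 1) \<le> t0 + 2 * pi) \<and>
        (\<forall>k. Suc k < r \<longrightarrow> b k \<le> a (Suc k)) \<and>
        (0 < r \<longrightarrow> emeasure (\<mu> (r - 1)) {cis t0} = 0))"

definition trig_list :: "nat \<Rightarrow> (real \<Rightarrow> real) \<Rightarrow> (real \<Rightarrow> real) list" where
  "trig_list m f =
     (if even m then
        concat (map (\<lambda>k. [\<lambda>\<theta>. f \<theta> * cos ((2 * real k - 1) / 2 * \<theta>),
                           \<lambda>\<theta>. f \<theta> * sin ((2 * real k - 1) / 2 * \<theta>)]) [1..<m div 2 + 1])
      else
        (\<lambda>\<theta>. f \<theta>) #
        concat (map (\<lambda>k. [\<lambda>\<theta>. f \<theta> * cos (real k * \<theta>),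
                           \<lambda>\<theta>. f \<theta> * sin (real k * \<theta>)]) [1..<(m - 1) div 2 + 1]))"

definition det_fun :: "nat \<Rightarrow> (nat \<Rightarrow> nat \<Rightarrow> real) \<Rightarrow> real" where
  "det_fun N A = (\<Sum>p | p permutes {..<N}. of_int (sign p) * (\<Prod>i<N. A i (p i)))"

definition chebyshev_system :: "real \<Rightarrow> real \<Rightarrow> (real \<Rightarrow> real) list \<Rightarrow> bool" where
  "chebyshev_system \<alpha> \<beta> us \<longleftrightarrow>
     (\<forall>xs. length xs = length us \<and> distinct xs \<and> set xs \<subseteq> {\<alpha>..\<beta>} \<longrightarrow>
        det_fun (length us) (\<lambda>i k. (us ! i) (xs ! k)) \<noteq> 0)"

definition AT_system :: "real \<Rightarrow> nat \<Rightarrow> (nat \<Rightarrow> complex measure) \<Rightarrow> bool" where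
  "AT_system t0 r \<mu> \<longleftrightarrow>
     (\<exists>\<alpha> \<beta> (\<mu>0 :: complex measure) (w :: nat \<Rightarrow> real \<Rightarrow> real).
        t0 = \<alpha> \<and> 0 < \<beta> - \<alpha> \<and> \<beta> - \<alpha> \<le> 2 * pi \<and>
        circle_measure \<mu>0 \<and> msupp \<mu>0 \<subseteq> arc \<alpha> \<beta> \<and>
        (\<forall>j<r. continuous_on {\<alpha>..\<beta>} (w j)) \<and>
        (\<forall>j<r. \<mu> j = density \<mu>0 (\<lambda>z. ennreal (w j (arg_from \<alpha> z)))) \<and>
        (\<forall>n :: nat \<Rightarrow> nat.
           chebyshev_system \<alpha> \<beta> (concat (map (\<lambda>j. trig_list (n j) (w j)) [0..<r]))))"

definition phi_fun :: "real \<Rightarrow> nat \<Rightarrow> (nat \<Rightarrow> complex) \<Rightarrow> complex \<Rightarrow> complex" where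
  "phi_fun t0 N c z = (\<Sum>m\<le>N. c m * hpow t0 (2 * int m - int N) z)"

text \<open>Orthogonality: int phi(z) z^(-p) d mu_j = 0 for p = -n_j/2, ..., n_j/2 - 1,
  i.e. p = (2i - n_j)/2 with i < n_j.\<close>
definition phi_orth :: "real \<Rightarrow> nat \<Rightarrow> (nat \<Rightarrow> complex measure) \<Rightarrow> (nat \<Rightarrow> nat)
                        \<Rightarrow> (nat \<Rightarrow> complex) \<Rightarrow> bool" where
  "phi_orth t0 r \<mu> n c \<longleftrightarrow>
     (\<forall>j<r. \<forall>i<n j.
        (\<integral>z. phi_fun t0 (\<Sum>l<r. n l) c z * hpow t0 (- (2 * int i - int (n j))) z \<partial>\<mu> j) = 0)"

end

theory Submission
  imports Defs "Jordan_Normal_Form.Determinant" "HOL-Complex_Analysis.Cauchy_Integral_Theorem"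
begin

text \<open>
  Write \<open>\<Phi> z = z\<^bsup>N/2\<^esup> \<phi> z\<close> with \<open>N = \<bar>n\<bar>\<close>, and let \<open>\<Phi>\<^sup>*\<close> be the reversed conjugate polynomial.
  If \<open>\<Phi>\<close> had a zero outside the open unit disc, then for some \<open>\<lambda> \<noteq> 0\<close> and some \<open>\<zeta>\<close> the polynomial
  \<open>\<lambda> z \<Phi> + cnj \<lambda> \<Phi>\<^sup>*\<close> would be divisible by \<open>(z - \<zeta>) (1 - cnj \<zeta> z)\<close>. On the circle this says that
  \<open>Re (\<lambda> z\<^bsup>1/2\<^esup> \<phi>) = \<bar>z - \<zeta>\<bar>\<^sup>2 g\<close> for a nonzero real trigonometric polynomial \<open>g\<close> of degree at most
  \<open>(N - 1) / 2\<close>, which has at most \<open>N - 1\<close> zeros. The orthogonality relations make \<open>g\<close> orthogonal, with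
  respect to the positive measures \<open>\<bar>z - \<zeta>\<bar>\<^sup>2 d\<mu>\<^sub>j\<close>, to all trigonometric polynomials of degree at most
  \<open>(n\<^sub>j - 1) / 2\<close> (with spectrum in the matching integers or half-integers). A function with fewer
  than \<open>k\<close> zeros cannot be orthogonal to a Chebyshev system of \<open>k\<close> functions: for an AT system this is
  applied with \<open>k = N\<close> to the whole system, for an Angelesco system with \<open>k = n\<^sub>j\<close> on an arc
  that contains fewer than \<open>n\<^sub>j\<close> zeros of \<open>g\<close>.
\<close>

section \<open>Determinants and Chebyshev systems\<close>

lemma det_fun_eq_det: "det_fun n A = Determinant.det (mat n n (\<lambda>(i,k). A i k))"
  unfolding det_fun_def Determinant.det_def
  by (auto simp: lessThan_atLeast0 permutes_in_image intro!: sum.cong prod.cong)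

lemma det_fun_eq_0_iff:
  "det_fun n A = 0 \<longleftrightarrow> (\<exists>v. (\<exists>k<n. v k \<noteq> 0) \<and> (\<forall>i<n. (\<Sum>k<n. A i k * v k) = 0))"
proof -
  let ?M = "mat n n (\<lambda>(i,k). A i k)"
  have "det_fun n A = 0 \<longleftrightarrow> (\<exists>v. v \<in> carrier_vec n \<and> v \<noteq> 0\<^sub>v n \<and> ?M *\<^sub>v v = 0\<^sub>v n)"
    unfolding det_fun_eq_det by (rule det_0_iff_vec_prod_zero) auto
  also have "\<dots> \<longleftrightarrow> (\<exists>v. (\<exists>k<n. v k \<noteq> 0) \<and> (\<forall>i<n. (\<Sum>k<n. A i k * v k) = 0))" (is "?L \<longleftrightarrow> ?R")
  proof
    assume ?L
    then obtain v where v: "v \<in> carrier_vec n" "v \<noteq> 0\<^sub>v n" "?M *\<^sub>v v = 0\<^sub>v n" by auto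
    have 1: "\<exists>k<n. v $ k \<noteq> 0" using v(1,2) by (metis carrier_vecD eq_vecI index_zero_vec)
    have "(\<Sum>k<n. A i k * v $ k) = 0" if "i < n" for i
    proof -
      have "(?M *\<^sub>v v) $ i = (\<Sum>k<n. A i k * v $ k)"
        using that v(1) by (auto simp: scalar_prod_def lessThan_atLeast0 intro!: sum.cong)
      then show ?thesis using v(3) that by simp
    qed
    then show ?R using 1 by blast
  next
    assume ?R
    then obtain v where v: "\<exists>k<n. v k \<noteq> 0" "\<And>i. i < n \<Longrightarrow> (\<Sum>k<n. A i k * v k) = 0" by blast
    have "vec n v \<noteq> 0\<^sub>v n" using v(1) by (metis index_vec index_zero_vec(1))
    moreover have "?M *\<^sub>v vec n v = 0\<^sub>v n"
      using v(2) by (intro eq_vecI) (auto simp: scalar_prod_def lessThan_atLeast0)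
    ultimately show ?L by (intro exI[of _ "vec n v"]) auto
  qed
  finally show ?thesis .
qed

lemma det_fun_transpose: "det_fun n (\<lambda>i k. A k i) = det_fun n A"
proof -
  have "mat n n (\<lambda>(i,k). A k i) = transpose_mat (mat n n (\<lambda>(i,k). A i k))"
    by (intro eq_matI) auto
  then show ?thesis unfolding det_fun_eq_det
    by (metis det_transpose mat_carrier)
qed

lemma det_fun_cong:
  "(\<And>i k. i < n \<Longrightarrow> k < n \<Longrightarrow> A i k = B i k) \<Longrightarrow> det_fun n A = det_fun n B"
  unfolding det_fun_eq_det by (intro arg_cong[where f=Determinant.det] cong_mat) auto

text \<open>Laplace expansion: \<open>C i\<close> is the cofactor at row \<open>i\<close>, obtained
  by grouping the permutations by the row that they send to \<open>k\<close>. What matters later is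
  that \<open>C\<close> is the same for all \<open>v\<close>, so that an integral can be pulled into
  a single column.\<close>

lemma det_fun_column:
  assumes "k < n"
  shows "\<exists>C. \<forall>v. det_fun n (\<lambda>i l. if l = k then v i else A i l) = (\<Sum>i<n. C i * v i)"
proof -
  let ?P = "{p. p permutes {..<n}}"
  define C where "C i = (\<Sum>p | p permutes {..<n} \<and> p i = k.
      of_int (sign p) * (\<Prod>j\<in>{..<n} - {i}. A j (p j)))" for i
  have fin: "finite ?P" by (simp add: finite_permutations)
  have "det_fun n (\<lambda>i l. if l = k then v i else A i l) = (\<Sum>i<n. C i * v i)" for v
  proof -
    let ?T = "\<lambda>p. of_int (sign p) * (\<Prod>i<n. if p i = k then v i else A i (p i))"
    have "(\<Sum>i<n. C i * v i) = (\<Sum>i<n. \<Sum>p | p \<in> ?P \<and> p i = k. ?T p)"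
    proof (rule sum.cong[OF refl])
      fix i assume i: "i \<in> {..<n}"
      have "(\<Prod>j<n. if p j = k then v j else A j (p j)) = v i * (\<Prod>j\<in>{..<n} - {i}. A j (p j))"
        if p: "p permutes {..<n}" "p i = k" for p
      proof -
        have "(\<Prod>j<n. if p j = k then v j else A j (p j))
            = v i * (\<Prod>j\<in>{..<n} - {i}. if p j = k then v j else A j (p j))"
          using i p by (subst prod.remove[of _ i]) auto
        moreover have "p j \<noteq> k" if "j \<noteq> i" for j
          using p that by (metis permutes_inverses(2))
        ultimately show ?thesis by (auto intro!: prod.cong arg_cong2[where f="(*)"])
      qed
      then show "C i * v i = (\<Sum>p | p \<in> ?P \<and> p i = k. ?T p)"
        unfolding C_def sum_distrib_right by (auto intro!: sum.cong)
    qed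
    also have "\<dots> = (\<Sum>i\<in>{..<n}. \<Sum>p\<in>?P. if p i = k then ?T p else 0)"
      by (intro sum.cong refl sum.inter_filter fin)
    also have "\<dots> = (\<Sum>p\<in>?P. \<Sum>i<n. if p i = k then ?T p else 0)" by (rule sum.swap)
    also have "\<dots> = (\<Sum>p\<in>?P. ?T p)"
    proof (rule sum.cong[OF refl])
      fix p assume "p \<in> ?P"
      then have p: "p permutes {..<n}" by simp
      \<comment> \<open>Each permutation is counted exactly once, for the row that is the preimage
        of \<open>k\<close>.\<close>
      have *: "inv_into UNIV p k < n" using p assms by (metis lessThan_iff permutes_in_image permutes_inv)
      have "p i = k \<longleftrightarrow> i = inv_into UNIV p k" for i using p by (metis permutes_inverses(1,2))
      then have "(\<Sum>i<n. if p i = k then ?T p else 0) = (\<Sum>i<n. if i = inv_into UNIV p k then ?T p else 0)"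
        by (intro sum.cong) auto
      then show "(\<Sum>i<n. if p i = k then ?T p else 0) = ?T p" using * by (simp add: sum.delta)
    qed
    finally show ?thesis unfolding det_fun_def by simp
  qed
  then show ?thesis by blast
qed

section \<open>Ordered pieces on which a function keeps its sign\<close>

definition sign_partition :: "(real \<Rightarrow> real) \<Rightarrow> real set \<Rightarrow> real set list \<Rightarrow> bool" where
  "sign_partition g I Es \<longleftrightarrow> sorted_wrt (\<lambda>A B. \<forall>x\<in>A. \<forall>y\<in>B. x < y) Es \<and>
     (\<forall>E\<in>set Es. E \<in> sets borel \<and> E \<subseteq> I \<and> (\<exists>s\<noteq>0. \<forall>x\<in>E. sgn (g x) = s))"

lemma sgn_constant_on_interval:
  fixes g :: "real \<Rightarrow> real"
  assumes "is_interval I" "continuous_on I g" "\<forall>x\<in>I. g x \<noteq> 0"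
  shows "\<exists>s\<noteq>0. \<forall>x\<in>I. sgn (g x) = s"
proof (cases "I = {}")
  case True
  then show ?thesis by (intro exI[of _ 1]) auto
next
  case False
  then obtain a where a: "a \<in> I" by auto
  have conn: "connected (g ` I)"
    using assms by (intro connected_continuous_image) (auto simp: is_interval_connected_1)
  have "sgn (g x) = sgn (g a)" if x: "x \<in> I" for x
  proof (rule ccontr)
    assume "sgn (g x) \<noteq> sgn (g a)"
    then have "g x < 0 \<and> 0 < g a \<or> g a < 0 \<and> 0 < g x"
      using assms(3) x a by (metis linorder_neqE_linordered_idom sgn_neg sgn_pos)
    moreover have "g x \<in> g ` I" "g a \<in> g ` I" using x a by auto
    ultimately have "0 \<in> g ` I"
      using connectedD_interval[OF conn, of "g x" "g a" 0] connectedD_interval[OF conn, of "g a" "g x" 0]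
      by linarith
    then show False using assms(3) by auto
  qed
  moreover have "sgn (g a) \<noteq> 0" using assms(3) a by (simp add: sgn_zero_iff)
  ultimately show ?thesis by blast
qed

text \<open>Induction on the largest point \<open>b\<close> of \<open>Z\<close>: what lies to the
  right of \<open>b\<close> is the last piece, and the rest of \<open>I\<close> falls under the
  induction hypothesis. \<open>Z\<close> need only contain the zeros, which lets it survive the
  passage to a smaller \<open>I\<close>. The number of pieces is exact because pieces may be
  empty.\<close>

lemma sign_partition_exists:
  fixes g :: "real \<Rightarrow> real"
  assumes "finite Z" "is_interval I" "continuous_on I g" "{x\<in>I. g x = 0} \<subseteq> Z"
  shows "\<exists>Es. length Es = Suc (card Z) \<and> sign_partition g I Es \<and> I - Z \<subseteq> \<Union>(set Es)"
  using assms
proof (induction Z arbitrary: I rule: finite_linorder_max_induct)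
  case empty
  then show ?case using sgn_constant_on_interval[of I g]
    by (intro exI[of _ "[I]"]) (auto simp: sign_partition_def real_interval_borel_measurable)
next
  case (insert b Z)
  have "is_interval (I \<inter> {..<b})" and Ib: "is_interval (I \<inter> {b<..})"
    using insert.prems(1) by (auto intro: is_interval_Int)
  moreover have "continuous_on (I \<inter> {..<b}) g" and cb: "continuous_on (I \<inter> {b<..}) g"
    using insert.prems(2) by (auto elim: continuous_on_subset)
  ultimately obtain Es where Es: "length Es = Suc (card Z)" "sign_partition g (I \<inter> {..<b}) Es"
      "I \<inter> {..<b} - Z \<subseteq> \<Union>(set Es)"
    using insert.IH[of "I \<inter> {..<b}"] insert.prems(3) by auto
  have "\<forall>x\<in>I \<inter> {b<..}. g x \<noteq> 0" using insert.prems(3) insert.hyps(2) by force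
  from sgn_constant_on_interval[OF Ib cb this] obtain s where
    "s \<noteq> 0" "\<forall>x\<in>I \<inter> {b<..}. sgn (g x) = s" by blast
  moreover have "b \<notin> Z" using insert.hyps by auto
  ultimately have len: "length (Es @ [I \<inter> {b<..}]) = Suc (card (insert b Z))"
    and part: "\<forall>E\<in>set (Es @ [I \<inter> {b<..}]). E \<in> sets borel \<and> E \<subseteq> I \<and> (\<exists>s\<noteq>0. \<forall>x\<in>E. sgn (g x) = s)"
    using Es(1,2) insert.hyps(1) real_interval_borel_measurable[OF Ib]
    unfolding sign_partition_def by auto
  have "\<forall>E\<in>set Es. E \<subseteq> {..<b}" using Es(2) by (auto simp: sign_partition_def)
  then have "sorted_wrt (\<lambda>A B. \<forall>x\<in>A. \<forall>y\<in>B. x < y) (Es @ [I \<inter> {b<..}])"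
    using Es(2) by (force simp: sorted_wrt_append sign_partition_def)
  moreover have "I - insert b Z \<subseteq> \<Union>(set (Es @ [I \<inter> {b<..}]))"
  proof
    fix x assume x: "x \<in> I - insert b Z"
    then consider "x \<in> I \<inter> {..<b} - Z" | "x \<in> I \<inter> {b<..}" by force
    then show "x \<in> \<Union>(set (Es @ [I \<inter> {b<..}]))" using Es(3) by cases auto
  qed
  ultimately show ?case using len part unfolding sign_partition_def by blast
qed

text \<open>If no cut leaves mass on both sides, the cuts with a null right part form an up-set. Let
  \<open>p\<close> be its infimum: the mass of \<open>E\<close> to the right of \<open>p\<close> and
  the mass to the left of \<open>p\<close> both vanish, so everything sits at \<open>p\<close>,
  against \<open>nd\<close>.\<close>

lemma split_non_dirac:
  fixes K :: "real measure"
  assumes K: "sets K = sets borel" and E: "E \<in> sets borel" "E \<subseteq> {a..b}" "emeasure K E \<noteq> 0"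
    and nd: "\<And>p. emeasure K (E - {p}) \<noteq> 0"
  shows "\<exists>d. emeasure K (E \<inter> {..<d}) \<noteq> 0 \<and> emeasure K (E \<inter> {d..}) \<noteq> 0"
proof (rule ccontr)
  assume "\<not> ?thesis"
  then have H: "emeasure K (E \<inter> {..<d}) = 0 \<or> emeasure K (E \<inter> {d..}) = 0" for d by blast
  have meas: "E \<inter> {..<d} \<in> sets K" "E \<inter> {d..} \<in> sets K" for d
    using E(1) unfolding K by simp_all
  define D where "D = {d. emeasure K (E \<inter> {d..}) = 0}"
  have up: "d' \<in> D" if "d \<in> D" "d \<le> d'" for d d'
  proof -
    have "emeasure K (E \<inter> {d'..}) \<le> emeasure K (E \<inter> {d..})"
      using that by (intro emeasure_mono meas) auto
    then show ?thesis using that by (simp add: D_def)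
  qed
  have "E \<inter> {b+1..} = {}" using E(2) by force
  then have "b + 1 \<in> D" by (simp add: D_def)
  have "E \<inter> {a..} = E" using E(2) by force
  then have "a \<notin> D" using E(3) by (simp add: D_def)
  then have lb: "a \<le> d" if "d \<in> D" for d using up[OF that, of a] by force
  then have bdd: "bdd_below D" by (auto simp: bdd_below_def)
  define p where "p = Inf D"
  have "E - {p} = (\<Union>k::nat. E \<inter> {p + 1 / Suc k..}) \<union> (\<Union>k::nat. E \<inter> {..<p - 1 / Suc k})"
    (is "_ = ?U")
  proof
    show "?U \<subseteq> E - {p}" by (auto simp: field_simps)
    show "E - {p} \<subseteq> ?U"
    proof
      fix x assume x: "x \<in> E - {p}"
      consider "x < p" | "p < x" using x by force
      then show "x \<in> ?U"
      proof cases
        case 1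
        then obtain k :: nat where "1 / Suc k < p - x"
          using reals_Archimedean[of "p - x"] by (auto simp: inverse_eq_divide)
        then have "x \<in> E \<inter> {..<p - 1 / Suc k}" using x by simp
        then show ?thesis by blast
      next
        case 2
        then obtain k :: nat where "1 / Suc k < x - p"
          using reals_Archimedean[of "x - p"] by (auto simp: inverse_eq_divide)
        then have "x \<in> E \<inter> {p + 1 / Suc k..}" using x by simp
        then show ?thesis by blast
      qed
    qed
  qed
  moreover have "?U \<in> null_sets K"
  proof (intro null_sets.Un null_sets_UN)
    fix k :: nat
    have "p < p + 1 / Suc k" by simp
    then obtain d where "d \<in> D" "d < p + 1 / Suc k"
      unfolding p_def using \<open>b + 1 \<in> D\<close> by (metis cInf_lessD empty_iff)
    then have "p + 1 / Suc k \<in> D" using up by simp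
    then show "E \<inter> {p + 1 / Suc k..} \<in> null_sets K" by (simp add: D_def null_sets_def meas)
    \<comment> \<open>Below the infimum the right part has positive measure, so by \<open>H\<close>
      the left part is the null one.\<close>
    have "p - 1 / Suc k \<notin> D"
    proof
      assume "p - 1 / Suc k \<in> D"
      then have "p \<le> p - 1 / Suc k" unfolding p_def by (intro cInf_lower bdd)
      then show False by simp
    qed
    then have "emeasure K (E \<inter> {..<p - 1 / Suc k}) = 0"
      using H[of "p - 1 / Suc k"] unfolding D_def by blast
    then show "E \<inter> {..<p - 1 / Suc k} \<in> null_sets K"
      using meas by (intro null_setsI)
  qed
  ultimately show False using nd[of p] by auto
qed

text \<open>Pieces are split one at a time. Some piece is not concentrated at one point, since
  otherwise one point per piece would give a finite set carrying \<open>K\<close>. Neighbouring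
  pieces may share their sign afterwards, which is harmless.\<close>

lemma sign_partition_refine:
  fixes K :: "real measure"
  assumes K: "sets K = sets borel" and I: "I \<subseteq> {a..b}"
    and inf: "\<And>F. finite F \<Longrightarrow> \<not> (AE x in K. x \<in> F)"
    and Es: "sign_partition g I Es" "\<forall>E\<in>set Es. emeasure K E \<noteq> 0" "AE x in K. x \<in> \<Union>(set Es)"
  shows "\<exists>Es'. length Es' = length Es + m \<and> sign_partition g I Es' \<and>
           (\<forall>E\<in>set Es'. emeasure K E \<noteq> 0) \<and> (AE x in K. x \<in> \<Union>(set Es'))"
proof (induction m)
  case 0
  then show ?case using Es by auto
next
  case (Suc m)
  then obtain Fs where Fs: "length Fs = length Es + m" "sign_partition g I Fs"
    "\<forall>E\<in>set Fs. emeasure K E \<noteq> 0" "AE x in K. x \<in> \<Union>(set Fs)" by blast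
  have "\<exists>E\<in>set Fs. \<forall>p. emeasure K (E - {p}) \<noteq> 0"
  proof (rule ccontr)
    assume "\<not> ?thesis"
    then obtain p where p: "\<And>E. E \<in> set Fs \<Longrightarrow> emeasure K (E - {p E}) = 0" by metis
    have "AE x in K. \<forall>E\<in>set Fs. x \<notin> E - {p E}"
    proof (rule AE_finite_allI)
      fix E assume "E \<in> set Fs"
      then have "E - {p E} \<in> null_sets K"
        using p Fs(2) K by (auto simp: null_sets_def sign_partition_def)
      then show "AE x in K. x \<notin> E - {p E}" by (rule AE_not_in)
    qed simp
    with Fs(4) have "AE x in K. x \<in> p ` set Fs" by eventually_elim auto
    then show False using inf[of "p ` set Fs"] by simp
  qed
  then obtain E where E: "E \<in> set Fs" "\<And>p. emeasure K (E - {p}) \<noteq> 0" by blast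
  have Eb: "E \<in> sets borel" "E \<subseteq> I" using E(1) Fs(2) by (auto simp: sign_partition_def)
  obtain d where d: "emeasure K (E \<inter> {..<d}) \<noteq> 0" "emeasure K (E \<inter> {d..}) \<noteq> 0"
    using split_non_dirac[OF K Eb(1), of a b] Eb(2) I E Fs(3) by blast
  obtain xs ys where Fs_eq: "Fs = xs @ E # ys" using E(1) by (meson split_list)
  let ?Gs = "xs @ (E \<inter> {..<d}) # (E \<inter> {d..}) # ys"
  have "\<Union>(set ?Gs) = \<Union>(set Fs)" unfolding Fs_eq by auto
  moreover have "sign_partition g I ?Gs"
  proof -
    have "sorted_wrt (\<lambda>A B. \<forall>x\<in>A. \<forall>y\<in>B. x < y) ?Gs"
      using Fs(2) unfolding Fs_eq sign_partition_def sorted_wrt_append by auto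
    moreover have "E \<inter> {..<d} \<in> sets borel" "E \<inter> {d..} \<in> sets borel" using Eb(1) by simp_all
    ultimately show ?thesis
      using Fs(2) unfolding Fs_eq sign_partition_def by auto
  qed
  ultimately show ?case using Fs d
    by (intro exI[of _ ?Gs]) (auto simp: Fs_eq)
qed

section \<open>Chebyshev systems tested against functions with few zeros\<close>

text \<open>The increasing tuples form a convex set, on which the determinant cannot change sign.\<close>
lemma det_fun_constant_sign:
  fixes u :: "nat \<Rightarrow> real \<Rightarrow> real"
  assumes I: "is_interval I" and cont: "\<And>i. i < n \<Longrightarrow> continuous_on I (u i)"
    and nz: "\<And>x. strict_mono_on {..<n} x \<Longrightarrow> x ` {..<n} \<subseteq> I \<Longrightarrow> det_fun n (\<lambda>i k. u i (x k)) \<noteq> 0"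
    and x: "strict_mono_on {..<n} x" "x ` {..<n} \<subseteq> I"
    and y: "strict_mono_on {..<n} y" "y ` {..<n} \<subseteq> I"
  shows "sgn (det_fun n (\<lambda>i k. u i (x k))) = sgn (det_fun n (\<lambda>i k. u i (y k)))"
proof -
  define p where "p t k = (1 - t) * x k + t * y k" for t k
  have pI: "p t k \<in> I" if "t \<in> {0..1}" "k < n" for t k
  proof -
    have "x k \<in> I" "y k \<in> I" using x(2) y(2) that by auto
    then show ?thesis using convexD_alt[OF is_interval_convex[OF I], of "x k" "y k" t] that
      by (simp add: p_def)
  qed
  have mono: "strict_mono_on {..<n} (p t)" if t: "t \<in> {0..1}" for t
  proof (rule strict_mono_onI)
    fix k l assume kl: "k \<in> {..<n}" "l \<in> {..<n}" "k < l"
    then have *: "x k < x l" "y k < y l" using strict_mono_onD[OF x(1)] strict_mono_onD[OF y(1)] by auto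
    consider "t = 0" | "0 < t" using t by force
    then show "p t k < p t l"
    proof cases
      case 1
      then show ?thesis using * by (simp add: p_def)
    next
      case 2
      then have "t * y k < t * y l" "(1 - t) * x k \<le> (1 - t) * x l"
        using * t by (auto intro!: mult_strict_left_mono mult_left_mono)
      then show ?thesis by (simp add: p_def)
    qed
  qed
  let ?D = "\<lambda>t. det_fun n (\<lambda>i k. u i (p t k))"
  have "continuous_on {0..1} (\<lambda>t. u i (p t k))" if "i < n" "k < n" for i k
  proof (rule continuous_on_compose2[OF cont])
    show "continuous_on {0..1} (\<lambda>t. p t k)" unfolding p_def by (intro continuous_intros)
  qed (use pI that in auto)
  then have "continuous_on {0..1} ?D"
    unfolding det_fun_def
    by (intro continuous_on_sum continuous_on_mult continuous_on_const continuous_on_prod)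
      (use permutes_in_image in fastforce)
  moreover have "\<forall>t\<in>{0..1}. ?D t \<noteq> 0"
  proof
    fix t :: real assume t: "t \<in> {0..1}"
    then have "p t ` {..<n} \<subseteq> I" using pI by auto
    with mono[OF t] show "?D t \<noteq> 0" by (rule nz)
  qed
  ultimately obtain s where "\<forall>t\<in>{0..1}. sgn (?D t) = s"
    using sgn_constant_on_interval[of "{0..1}" ?D] is_interval_cc by blast
  then have "sgn (?D 0) = sgn (?D 1)" by simp
  then show ?thesis by (simp add: p_def)
qed

text \<open>The columns of the matrix \<open>A\<close> below are the integrals of \<open>(u 0, \<dots>, u (n - 1))\<close> over
  consecutive pieces on which \<open>g\<close> does not change sign. Its determinant is not zero, because one
  can replace the columns of a nonvanishing \<open>det (u i (x k))\<close> of constant sign by integrals, one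
  at a time; annihilation would make the vector of signs of \<open>g\<close> a kernel vector.\<close>
lemma chebyshev_system_not_annihilated:
  fixes K :: "real measure" and u :: "nat \<Rightarrow> real \<Rightarrow> real" and g :: "real \<Rightarrow> real"
  assumes K: "sets K = sets borel" and I: "is_interval I" "I \<subseteq> {a..b}"
    and inf: "\<And>F. finite F \<Longrightarrow> \<not> (AE x in K. x \<in> F)"
    and K_I: "AE x in K. x \<in> I" and K_g: "AE x in K. g x \<noteq> 0"
    and g_meas: "g \<in> borel_measurable K" and g: "continuous_on I g" "finite {x\<in>I. g x = 0}" "card {x\<in>I. g x = 0} < n"
    and u: "\<And>i. i < n \<Longrightarrow> continuous_on I (u i)" "\<And>i. i < n \<Longrightarrow> integrable K (u i)"
    and nz: "\<And>x. strict_mono_on {..<n} x \<Longrightarrow> x ` {..<n} \<subseteq> I \<Longrightarrow> det_fun n (\<lambda>i k. u i (x k)) \<noteq> 0"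
  shows "\<exists>i<n. (\<integral>x. u i x * sgn (g x) \<partial>K) \<noteq> 0"
proof (rule ccontr)
  assume "\<not> ?thesis"
  then have ann: "(\<integral>x. u i x * sgn (g x) \<partial>K) = 0" if "i < n" for i using that by blast
  obtain Es0 where Es0: "length Es0 = Suc (card {x\<in>I. g x = 0})" "sign_partition g I Es0"
      "I - {x\<in>I. g x = 0} \<subseteq> \<Union>(set Es0)"
    using sign_partition_exists[OF g(2) I(1) g(1) order.refl] by blast
  \<comment> \<open>A null piece would produce a zero column of integrals, so such pieces are
    dropped before the others are refined.\<close>
  define Es1 where "Es1 = filter (\<lambda>E. emeasure K E \<noteq> 0) Es0"
  have Es1: "sign_partition g I Es1" "\<forall>E\<in>set Es1. emeasure K E \<noteq> 0"
    using Es0(2) by (auto simp: Es1_def sign_partition_def sorted_wrt_filter)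
  \<comment> \<open>There is one piece more than there are zeros, so fewer than \<open>n\<close>
    zeros give at most \<open>n\<close> pieces; refinement then brings their number to exactly
    \<open>n\<close> and makes the matrix square.\<close>
  have "length Es1 \<le> length Es0" unfolding Es1_def by (rule length_filter_le)
  then have len1: "length Es1 \<le> n" using Es0(1) g(3) by simp
  have "AE x in K. \<forall>E\<in>{E\<in>set Es0. emeasure K E = 0}. x \<notin> E"
  proof (rule AE_finite_allI)
    fix E assume "E \<in> {E\<in>set Es0. emeasure K E = 0}"
    then have "E \<in> null_sets K" using Es0(2) K by (auto simp: sign_partition_def null_sets_def)
    then show "AE x in K. x \<notin> E" by (rule AE_not_in)
  qed simp
  then have "AE x in K. x \<in> \<Union>(set Es1)"
    using K_I K_g
  proof eventually_elim
    case (elim x)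
    then obtain E where "E \<in> set Es0" "x \<in> E" using Es0(3) by blast
    then show ?case using elim(1) unfolding Es1_def by auto
  qed
  from sign_partition_refine[OF K I(2) inf Es1 this, of "n - length Es1"] len1
  obtain Es where Es: "length Es = n" "sign_partition g I Es" "\<forall>E\<in>set Es. emeasure K E \<noteq> 0"
    "AE x in K. x \<in> \<Union>(set Es)" by auto
  define E where "E k = Es ! k" for k
  have E: "E k \<in> sets borel" "E k \<subseteq> I" "emeasure K (E k) \<noteq> 0" "\<exists>s\<noteq>0. \<forall>x\<in>E k. sgn (g x) = s"
    if "k < n" for k
    using Es(2,3) that Es(1) by (auto simp: E_def sign_partition_def)
  have E_less: "x < y" if "k < l" "l < n" "x \<in> E k" "y \<in> E l" for k l x y
    using Es(1,2) that unfolding sign_partition_def sorted_wrt_iff_nth_less E_def by blast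
  have E_disj: "x \<notin> E l" if "x \<in> E k" "k < n" "l < n" "k \<noteq> l" for k l x
    using that E_less[of k l x x] E_less[of l k x x] by (metis less_irrefl nat_neq_iff)
  have E_cover: "AE x in K. \<exists>k<n. x \<in> E k"
    using Es(4)
  proof eventually_elim
    case (elim x)
    then show ?case by (metis E_def Es(1) UnionE in_set_conv_nth)
  qed
  have incr: "strict_mono_on {..<n} x" "x ` {..<n} \<subseteq> I" if "\<And>k. k < n \<Longrightarrow> x k \<in> E k" for x
    using that E(2) E_less by (auto intro!: strict_mono_onI) 
  have "\<forall>k. \<exists>x. k < n \<longrightarrow> x \<in> E k" using E(3) by (metis emeasure_empty equals0I)
  then obtain x0 where x0: "\<And>k. k < n \<Longrightarrow> x0 k \<in> E k" by metis
  define \<epsilon> where "\<epsilon> = sgn (det_fun n (\<lambda>i k. u i (x0 k)))"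
  have "\<epsilon> \<noteq> 0" unfolding \<epsilon>_def using nz[OF incr[of x0]] x0 by (simp add: sgn_zero_iff)
  define A where "A i k = (\<integral>x. indicator (E k) x * u i x \<partial>K)" for i k
  have ind_int: "integrable K (\<lambda>x. indicator (E k) x * f x)"
    if "k < n" "integrable K f" for k and f :: "real \<Rightarrow> real"
    using integrable_mult_indicator[of "E k" K f] that E(1) K by simp
  \<comment> \<open>The first \<open>m\<close> columns are already integrals. The points
    \<open>x\<close> stay arbitrary in the induction, because the next step lets the point of column
    \<open>m\<close> run through all of \<open>E m\<close>.\<close>
  have pos: "\<epsilon> * det_fun n (\<lambda>i k. if k < m then A i k else u i (x k)) > 0"
    if "m \<le> n" "\<And>k. k < n \<Longrightarrow> x k \<in> E k" for m x
    using that
  proof (induction m arbitrary: x)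
    case 0
    have "sgn (det_fun n (\<lambda>i k. u i (x k))) = \<epsilon>" unfolding \<epsilon>_def
      by (rule det_fun_constant_sign[OF I(1) u(1) nz]) (use incr 0 x0 in auto)
    moreover have "det_fun n (\<lambda>i k. u i (x k)) \<noteq> 0" using nz incr 0 by blast
    ultimately show ?case by (auto simp: sgn_if split: if_splits)
  next
    case (Suc m)
    then have m: "m < n" by simp
    obtain C where C: "\<And>v. det_fun n (\<lambda>i l. if l = m then v i else if l < m then A i l else u i (x l))
        = (\<Sum>i<n. C i * v i)"
      using det_fun_column[OF m] by meson
    \<comment> \<open>As a function of the point in column \<open>m\<close> the signed determinant
      is a fixed linear combination of the \<open>u i\<close>, positive on \<open>E m\<close> by
      induction. Its integral over \<open>E m\<close> is the signed determinant with column
      \<open>m\<close> integrated.\<close>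
    define h where "h y = \<epsilon> * (\<Sum>i<n. C i * u i y)" for y
    have h_pos: "h y > 0" if y: "y \<in> E m" for y
    proof -
      have "\<epsilon> * det_fun n (\<lambda>i k. if k < m then A i k else u i ((x(m := y)) k)) > 0"
        by (rule Suc.IH) (use Suc.prems y in auto)
      also have "(\<lambda>i k. if k < m then A i k else u i ((x(m := y)) k))
          = (\<lambda>i l. if l = m then u i y else if l < m then A i l else u i (x l))"
        by (intro ext) auto
      finally show ?thesis unfolding C h_def .
    qed
    have h_int: "integrable K h"
      unfolding h_def using u(2) by (intro integrable_mult_right integrable_sum) auto
    have "\<epsilon> * (\<Sum>i<n. C i * A i m) = (\<integral>y. indicator (E m) y * h y \<partial>K)"
    proof -
      have "(\<integral>y. indicator (E m) y * h y \<partial>K)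
          = (\<integral>y. \<epsilon> * (\<Sum>i<n. C i * (indicator (E m) y * u i y)) \<partial>K)"
        unfolding h_def by (simp add: sum_distrib_left mult_ac)
      also have "\<dots> = \<epsilon> * (\<Sum>i<n. C i * A i m)"
        using ind_int[OF m u(2)] by (simp add: A_def)
      finally show ?thesis by simp
    qed
    also have "\<dots> > 0"
    proof -
      let ?f = "\<lambda>y. indicator (E m) y * h y"
      have nn: "?f y \<ge> 0" for y using h_pos by (simp add: indicator_def less_imp_le)
      \<comment> \<open>Strict positivity survives integration because \<open>E m\<close> is not a
        null set.\<close>
      have "integral\<^sup>L K ?f \<noteq> 0"
      proof
        assume "integral\<^sup>L K ?f = 0"
        then have "AE y in K. ?f y = 0"
          using integral_nonneg_eq_0_iff_AE[OF ind_int[OF m h_int]] nn by simp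
        then have "AE y in K. y \<notin> E m"
        proof eventually_elim
          case (elim y)
          then show ?case using h_pos[of y] by (auto simp: indicator_def)
        qed
        then show False using E(1,3)[OF m] K AE_iff_null_sets[of "E m" K] by (auto simp: null_sets_def)
      qed
      moreover have "integral\<^sup>L K ?f \<ge> 0" using nn by simp
      ultimately show ?thesis by simp
    qed
    also have "(\<Sum>i<n. C i * A i m) = det_fun n (\<lambda>i k. if k < Suc m then A i k else u i (x k))"
      unfolding C[symmetric] by (rule arg_cong[where f="det_fun n"]) (auto simp: fun_eq_iff less_Suc_eq)
    finally show ?case .
  qed
  have "det_fun n (\<lambda>i k. if k < n then A i k else u i (x0 k)) = det_fun n A"
    by (rule det_fun_cong) auto
  then have "det_fun n A \<noteq> 0" using pos[of n x0] x0 by auto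
  moreover have "det_fun n A = 0" unfolding det_fun_eq_0_iff
  proof -
    \<comment> \<open>The kernel vector consists of the signs of \<open>g\<close> on the pieces:
      weighting the integrals of \<open>u i\<close> by them gives the integral of \<open>u i\<close>
      against \<open>sgn (g x)\<close>, which is 0 by \<open>ann\<close>.\<close>
    have "\<forall>k. \<exists>s. k < n \<longrightarrow> s \<noteq> 0 \<and> (\<forall>x\<in>E k. sgn (g x) = s)" using E(4) by blast
    then obtain s where s: "\<And>k. k < n \<Longrightarrow> s k \<noteq> 0" "\<And>k x. k < n \<Longrightarrow> x \<in> E k \<Longrightarrow> sgn (g x) = s k"
      by metis
    have "(\<Sum>k<n. A i k * s k) = 0" if i: "i < n" for i
    proof -
      have "(\<Sum>k<n. A i k * s k) = (\<integral>x. (\<Sum>k<n. indicator (E k) x * u i x * s k) \<partial>K)"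
        unfolding A_def using ind_int u(2) i by (subst Bochner_Integration.integral_sum) auto
      also have "\<dots> = (\<integral>x. u i x * sgn (g x) \<partial>K)"
      proof (rule integral_cong_AE)
        have ui: "u i \<in> borel_measurable K" using u(2)[OF i] by simp
        have Ek: "indicator (E k) \<in> borel_measurable K" if "k < n" for k
          using E(1)[OF that] K by (intro borel_measurable_indicator) simp
        have ae: "AE x in K. (\<Sum>k<n. indicator (E k) x * u i x * s k) = u i x * sgn (g x)"
          using E_cover
        proof eventually_elim
          case (elim x)
          then obtain k where k: "k < n" "x \<in> E k" by blast
          have "(\<Sum>l<n. indicator (E l) x * u i x * s l) = (\<Sum>l<n. if l = k then u i x * s l else 0)"
            using k E_disj by (intro sum.cong) (auto simp: indicator_def)
          then show ?case using k s(2) by (simp add: sum.delta)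
        qed
        then show "AE x in K. (\<Sum>k<n. indicator (E k) x * u i x * s k) = u i x * sgn (g x)" .
        show m1: "(\<lambda>x. \<Sum>k<n. indicator (E k) x * u i x * s k) \<in> borel_measurable K"
          using Ek ui by (intro borel_measurable_sum borel_measurable_times) auto
        show "(\<lambda>x. u i x * sgn (g x)) \<in> borel_measurable K"
          using ui measurable_compose[OF g_meas borel_measurable_sgn] by (rule borel_measurable_times)
      qed
      also have "\<dots> = 0" by (rule ann[OF i])
      finally show ?thesis .
    qed
    moreover have "0 < n" using g(3) by simp
    ultimately show "\<exists>v. (\<exists>k<n. v k \<noteq> 0) \<and> (\<forall>i<n. (\<Sum>k<n. A i k * v k) = 0)"
      using s(1) by blast
  qed
  ultimately show False by simp
qed

section \<open>Trigonometric polynomials\<close>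

text \<open>Here \<open>m\<close> is twice the usual degree: the frequencies are \<open>-m/2, -m/2 + 1, \<dots>, m/2\<close>.\<close>
definition trig_poly :: "nat \<Rightarrow> (real \<Rightarrow> complex) \<Rightarrow> bool" where
  "trig_poly m f \<longleftrightarrow> (\<exists>p. degree p \<le> m \<and> (\<forall>\<theta>. f \<theta> = cis (- (real m * \<theta> / 2)) * poly p (cis \<theta>)))"

lemma trig_poly_const: "trig_poly 0 (\<lambda>\<theta>. a)"
  unfolding trig_poly_def by (intro exI[of _ "[:a:]"]) simp

lemma trig_poly_cmult: "trig_poly m f \<Longrightarrow> trig_poly m (\<lambda>\<theta>. a * f \<theta>)"
proof -
  assume "trig_poly m f"
  then obtain p where "degree p \<le> m" "\<And>\<theta>. f \<theta> = cis (- (real m * \<theta> / 2)) * poly p (cis \<theta>)"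
    unfolding trig_poly_def by blast
  then show ?thesis unfolding trig_poly_def
    by (intro exI[of _ "Polynomial.smult a p"]) (simp add: order.trans[OF degree_smult_le])
qed

lemma trig_poly_add: "trig_poly m f \<Longrightarrow> trig_poly m g \<Longrightarrow> trig_poly m (\<lambda>\<theta>. f \<theta> + g \<theta>)"
proof -
  assume "trig_poly m f" "trig_poly m g"
  then obtain p q where "degree p \<le> m" "\<And>\<theta>. f \<theta> = cis (- (real m * \<theta> / 2)) * poly p (cis \<theta>)"
     "degree q \<le> m" "\<And>\<theta>. g \<theta> = cis (- (real m * \<theta> / 2)) * poly q (cis \<theta>)"
    unfolding trig_poly_def by blast
  then show ?thesis unfolding trig_poly_def
    by (intro exI[of _ "p + q"]) (simp add: degree_add_le ring_distribs)
qed

lemma trig_poly_mult: "trig_poly m f \<Longrightarrow> trig_poly l g \<Longrightarrow> trig_poly (m + l) (\<lambda>\<theta>. f \<theta> * g \<theta>)"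
proof -
  assume "trig_poly m f" "trig_poly l g"
  then obtain p q where p: "degree p \<le> m" "\<And>\<theta>. f \<theta> = cis (- (real m * \<theta> / 2)) * poly p (cis \<theta>)"
    and q: "degree q \<le> l" "\<And>\<theta>. g \<theta> = cis (- (real l * \<theta> / 2)) * poly q (cis \<theta>)"
    unfolding trig_poly_def by blast
  have "cis (- (real (m + l) * \<theta> / 2)) = cis (- (real m * \<theta> / 2)) * cis (- (real l * \<theta> / 2))" for \<theta>
    by (simp add: cis_mult algebra_simps add_divide_distrib)
  moreover have "degree (p * q) \<le> m + l" using p(1) q(1) by (meson add_mono degree_mult_le order.trans)
  ultimately show ?thesis unfolding trig_poly_def
    by (intro exI[of _ "p * q"]) (simp add: p(2) q(2))
qed

lemma trig_poly_power: "trig_poly 1 f \<Longrightarrow> trig_poly k (\<lambda>\<theta>. f \<theta> ^ k)"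
proof (induction k)
  case (Suc k)
  then show ?case using trig_poly_mult[of 1 f k "\<lambda>\<theta>. f \<theta> ^ k"] by simp
qed (simp add: trig_poly_const)

lemma trig_poly_sum:
  "(\<And>i. i \<in> A \<Longrightarrow> trig_poly m (f i)) \<Longrightarrow> trig_poly m (\<lambda>\<theta>. \<Sum>i\<in>A. f i \<theta>)"
proof (induction A rule: infinite_finite_induct)
  case (insert x F)
  then show ?case by (simp add: trig_poly_add)
qed (auto simp: trig_poly_def intro: exI[of _ 0])

lemma cis_half_shift: "cis (- (real m * \<theta> / 2)) * cis \<theta> ^ k = cis ((2 * real k - real m) / 2 * \<theta>)"
  unfolding Complex.DeMoivre cis_mult by (rule arg_cong[of _ _ cis]) (simp add: field_simps)

lemma trig_poly_cis:
  assumes "k \<le> m"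
  shows "trig_poly m (\<lambda>\<theta>. cis ((2 * real k - real m) / 2 * \<theta>))"
  using assms unfolding trig_poly_def cis_half_shift[symmetric]
  by (intro exI[of _ "monom 1 k"]) (simp add: poly_monom degree_monom_eq)

text \<open>Conjugation negates frequencies, so position \<open>k\<close> moves to
  \<open>m - k\<close> and the symmetric spectrum is preserved.\<close>

lemma trig_poly_cnj:
  assumes "trig_poly m f"
  shows "trig_poly m (\<lambda>\<theta>. cnj (f \<theta>))"
proof -
  obtain p where p: "degree p \<le> m" "\<And>\<theta>. f \<theta> = cis (- (real m * \<theta> / 2)) * poly p (cis \<theta>)"
    using assms unfolding trig_poly_def by blast
  have "cnj (f \<theta>) = (\<Sum>k\<le>m. cnj (coeff p k) * cis ((2 * real (m - k) - real m) / 2 * \<theta>))" for \<theta>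
  proof -
    have "f \<theta> = cis (- (real m * \<theta> / 2)) * (\<Sum>k\<le>m. coeff p k * cis \<theta> ^ k)"
      unfolding p(2)
      using arg_cong[OF poly_as_sum_of_monoms'[OF p(1)], of "\<lambda>p. poly p (cis \<theta>)"]
      by (simp add: poly_sum poly_monom)
    also have "\<dots> = (\<Sum>k\<le>m. coeff p k * cis (- ((2 * real (m - k) - real m) / 2 * \<theta>)))"
      unfolding sum_distrib_left
    proof (rule sum.cong[OF refl])
      fix k assume "k \<in> {..m}"
      then have "(2 * real k - real m) / 2 * \<theta> = - ((2 * real (m - k) - real m) / 2 * \<theta>)"
        by (simp add: of_nat_diff field_simps)
      then show "cis (- (real m * \<theta> / 2)) * (coeff p k * cis \<theta> ^ k)
          = coeff p k * cis (- ((2 * real (m - k) - real m) / 2 * \<theta>))"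
        unfolding mult.left_commute[of _ "coeff p k"] cis_half_shift by simp
    qed
    finally show ?thesis by (simp add: cis_cnj)
  qed
  then have eq: "(\<lambda>\<theta>. cnj (f \<theta>))
      = (\<lambda>\<theta>. \<Sum>k\<le>m. cnj (coeff p k) * cis ((2 * real (m - k) - real m) / 2 * \<theta>))" by (rule ext)
  show ?thesis unfolding eq by (intro trig_poly_sum trig_poly_cmult trig_poly_cis) simp
qed

lemma trig_poly_Re:
  assumes "trig_poly m f"
  shows "trig_poly m (\<lambda>\<theta>. complex_of_real (Re (f \<theta>)))"
proof -
  have "complex_of_real (Re (f \<theta>)) = 1 / 2 * (f \<theta> + cnj (f \<theta>))" for \<theta>
    by (simp add: complex_add_cnj)
  then have eq: "(\<lambda>\<theta>. complex_of_real (Re (f \<theta>))) = (\<lambda>\<theta>. 1 / 2 * (f \<theta> + cnj (f \<theta>)))" by (rule ext)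
  show ?thesis unfolding eq using assms by (intro trig_poly_cmult trig_poly_add trig_poly_cnj)
qed

lemma trig_poly_continuous: "trig_poly m f \<Longrightarrow> continuous_on UNIV f"
proof -
  assume "trig_poly m f"
  then obtain p where p: "f = (\<lambda>\<theta>. cis (- (real m * \<theta> / 2)) * poly p (cis \<theta>))"
    unfolding trig_poly_def by blast
  show ?thesis unfolding p by (intro continuous_intros continuous_on_cis) simp
qed

section \<open>Zeros in one period and the half-angle basis\<close>

lemma inj_on_cis: "inj_on cis {t..<t + 2 * pi}"
proof (rule inj_onI)
  fix x y assume xy: "x \<in> {t..<t + 2 * pi}" "y \<in> {t..<t + 2 * pi}" and "cis x = cis y"
  then obtain k :: int where k: "x = y + 2 * pi * k"
    using sin_cos_eq_iff[of x y] by (auto simp: complex_eq_iff)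
  then have "\<bar>2 * pi * k\<bar> < 2 * pi" using xy by auto
  then have "k = 0" by (simp add: abs_mult)
  then show "x = y" using k by simp
qed

text \<open>Up to a nonvanishing factor \<open>f\<close> is a polynomial of degree at most
  \<open>m\<close> in \<open>cis \<theta>\<close>, and \<open>cis\<close> is injective on a
  half-open period, so distinct zeros give distinct roots.\<close>

lemma trig_poly_zeros:
  assumes "trig_poly m f" "f \<theta>\<^sub>0 \<noteq> 0"
  shows "finite {\<theta>\<in>{t..<t + 2 * pi}. f \<theta> = 0}" "card {\<theta>\<in>{t..<t + 2 * pi}. f \<theta> = 0} \<le> m"
proof -
  obtain p where p: "degree p \<le> m" "\<And>\<theta>. f \<theta> = cis (- (real m * \<theta> / 2)) * poly p (cis \<theta>)"
    using assms unfolding trig_poly_def by blast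
  have "p \<noteq> 0" using assms(2) p(2) by auto
  then have fin: "finite {z. poly p z = 0}" by (rule poly_roots_finite)
  have inj: "inj_on cis {\<theta>\<in>{t..<t + 2 * pi}. f \<theta> = 0}"
    by (rule inj_on_subset[OF inj_on_cis[of t]]) auto
  have sub: "cis ` {\<theta>\<in>{t..<t + 2 * pi}. f \<theta> = 0} \<subseteq> {z. poly p z = 0}" by (auto simp: p(2))
  then show "finite {\<theta>\<in>{t..<t + 2 * pi}. f \<theta> = 0}"
    using inj fin by (meson finite_imageD finite_subset)
  have "card {\<theta>\<in>{t..<t + 2 * pi}. f \<theta> = 0} \<le> card {z. poly p z = 0}"
    by (rule card_inj_on_le[OF inj sub fin])
  also have "\<dots> \<le> m" using card_poly_roots_bound[OF \<open>p \<noteq> 0\<close>] p(1) by simp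
  finally show "card {\<theta>\<in>{t..<t + 2 * pi}. f \<theta> = 0} \<le> m" .
qed

lemma trig_poly_half_angle:
  "trig_poly 1 (\<lambda>\<theta>. complex_of_real (cos (\<theta> / 2)))" "trig_poly 1 (\<lambda>\<theta>. complex_of_real (sin (\<theta> / 2)))"
proof -
  have 1: "trig_poly 1 (\<lambda>\<theta>. cis (\<theta> / 2))" using trig_poly_cis[of 1 1] by simp
  from trig_poly_Re[OF this] show "trig_poly 1 (\<lambda>\<theta>. complex_of_real (cos (\<theta> / 2)))" by simp
  from trig_poly_Re[OF trig_poly_cmult[OF 1, of "- \<i>"]]
  show "trig_poly 1 (\<lambda>\<theta>. complex_of_real (sin (\<theta> / 2)))" by simp
qed

text \<open>For \<open>i < n\<close>, a basis of the real-valued functions satisfying \<open>trig_poly (n - 1)\<close>.\<close>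
definition half_angle_basis :: "nat \<Rightarrow> nat \<Rightarrow> real \<Rightarrow> real" where
  "half_angle_basis n i \<theta> = sin (\<theta> / 2) ^ i * cos (\<theta> / 2) ^ (n - 1 - i)"

lemma half_angle_basis_trig_poly:
  assumes "i < n"
  shows "trig_poly (n - 1) (\<lambda>\<theta>. complex_of_real (half_angle_basis n i \<theta>))"
proof -
  have "i + (n - 1 - i) = n - 1" using assms by simp
  then show ?thesis unfolding half_angle_basis_def of_real_mult of_real_power
    using trig_poly_mult[OF trig_poly_power[OF trig_poly_half_angle(2), of i]
        trig_poly_power[OF trig_poly_half_angle(1), of "n - 1 - i"]] by simp
qed


text \<open>A vanishing determinant yields a combination of the basis with \<open>n\<close> zeros in
  one period, hence identically zero. Divided by \<open>cos (\<theta> / 2) ^ (n - 1)\<close> it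
  becomes a polynomial in \<open>tan (\<theta> / 2)\<close>, whose coefficients must then
  vanish.\<close>

lemma half_angle_basis_det:
  assumes inj: "inj_on x {..<n}" and x: "x ` {..<n} \<subseteq> {t..<t + 2 * pi}"
  shows "det_fun n (\<lambda>i k. half_angle_basis n i (x k)) \<noteq> 0"
proof
  assume "det_fun n (\<lambda>i k. half_angle_basis n i (x k)) = 0"
  \<comment> \<open>Transposing turns the kernel vector into a linear relation between functions
    instead of one between points.\<close>
  then have "det_fun n (\<lambda>k i. half_angle_basis n i (x k)) = 0"
    using det_fun_transpose[of n "\<lambda>k i. half_angle_basis n i (x k)"] by simp
  then obtain v k0 where v: "k0 < n" "v k0 \<noteq> 0"
    "\<And>k. k < n \<Longrightarrow> (\<Sum>i<n. half_angle_basis n i (x k) * v i) = 0"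
    unfolding det_fun_eq_0_iff by blast
  define f where "f \<theta> = (\<Sum>i<n. half_angle_basis n i \<theta> * v i)" for \<theta>
  have f: "trig_poly (n - 1) (\<lambda>\<theta>. complex_of_real (f \<theta>))"
    unfolding f_def of_real_sum of_real_mult
    by (intro trig_poly_sum, subst mult.commute, intro trig_poly_cmult half_angle_basis_trig_poly) simp
  have f0: "f \<theta> = 0" for \<theta>
  proof (rule ccontr)
    assume "f \<theta> \<noteq> 0"
    then have "finite {\<theta>\<in>{t..<t + 2 * pi}. complex_of_real (f \<theta>) = 0}"
      "card {\<theta>\<in>{t..<t + 2 * pi}. complex_of_real (f \<theta>) = 0} \<le> n - 1"
      using trig_poly_zeros[OF f, of \<theta> t] by auto
    moreover have "x ` {..<n} \<subseteq> {\<theta>\<in>{t..<t + 2 * pi}. complex_of_real (f \<theta>) = 0}"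
      using x v(3) unfolding f_def by (fastforce simp del: of_real_sum)
    ultimately have "card (x ` {..<n}) \<le> n - 1" using card_mono order.trans by blast
    then show False using card_image[OF inj] v(1) by simp
  qed
  define q where "q = (\<Sum>i<n. monom (v i) i)"
  have "poly q y = 0" for y
  proof -
    \<comment> \<open>The substitution \<open>\<theta> = 2 * arctan y\<close> makes the tangent of
      the half angle equal to \<open>y\<close>, and the cosine does not vanish there.\<close>
    define c where "c = cos (arctan y)"
    have c: "c \<noteq> 0" unfolding c_def by (simp add: cos_arctan_not_zero)
    have s: "sin (arctan y) = y * c" unfolding c_def using tan_arctan[of y] c
      by (simp add: tan_def c_def field_simps)
    have "0 = f (2 * arctan y)" by (simp add: f0)
    also have "\<dots> = (\<Sum>i<n. c ^ (n - 1) * (v i * y ^ i))"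
    proof (unfold f_def, rule sum.cong[OF refl])
      fix i assume "i \<in> {..<n}"
      then have "c ^ (n - 1) = c ^ i * c ^ (n - 1 - i)" by (simp flip: power_add)
      then show "half_angle_basis n i (2 * arctan y) * v i = c ^ (n - 1) * (v i * y ^ i)"
        by (simp add: half_angle_basis_def s power_mult_distrib flip: c_def)
    qed
    also have "\<dots> = c ^ (n - 1) * poly q y" by (simp add: q_def poly_sum poly_monom sum_distrib_left)
    finally show ?thesis using c by simp
  qed
  then have "q = 0" using poly_all_0_iff_0 by blast
  moreover have "coeff q k0 = v k0" unfolding q_def using v(1) by (simp add: coeff_sum)
  ultimately show False using v(2) by simp
qed

section \<open>Zeros and their mirror images\<close>

text \<open>For unimodular \<open>l\<close> the equation amounts to
  \<open>l * l * A + B = 0\<close>. Equal moduli make the square root of \<open>- B / A\<close>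
  unimodular.\<close>

lemma unimodular_balance:
  fixes A B :: complex
  assumes "cmod A = cmod B"
  shows "\<exists>l. l \<noteq> 0 \<and> l * A + cnj l * B = 0"
proof (cases "A = 0")
  case True
  then show ?thesis using assms by (intro exI[of _ 1]) auto
next
  case False
  define l where "l = csqrt (- B / A)"
  have l2: "l * l = - B / A" unfolding l_def by (metis power2_csqrt power2_eq_square)
  have "cmod (l * l) = 1" unfolding l2 using False by (simp add: norm_divide flip: assms)
  then have "cmod l = 1" by (simp add: norm_mult) (metis abs_norm_cancel abs_square_eq_1 power2_eq_square)
  then have cl: "cnj l * l = 1" by (simp add: complex_norm_square[symmetric] mult.commute)
  have "l * (l * A + cnj l * B) = (l * l) * A + (cnj l * l) * B" by (simp add: algebra_simps)
  also have "\<dots> = 0" unfolding l2 cl using False by simp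
  finally show ?thesis using cl by (intro exI[of _ l]) auto
qed

section \<open>Reversed polynomials and a self-reciprocal combination\<close>

definition conj_reflect :: "complex poly \<Rightarrow> complex poly" where
  "conj_reflect p = map_poly cnj (reflect_poly p)"

lemma poly_conj_reflect:
  "z \<noteq> 0 \<Longrightarrow> poly (conj_reflect p) z = z ^ degree p * cnj (poly p (inverse (cnj z)))"
  by (simp add: conj_reflect_def poly_reflect_poly_nz)

lemma poly_conj_reflect_0: "poly (conj_reflect p) 0 = cnj (lead_coeff p)"
  by (simp add: conj_reflect_def)

lemma conj_reflect_mult: "conj_reflect (p * q) = conj_reflect p * conj_reflect q"
  by (intro poly_eq_poly_eq_iff[THEN iffD1] ext) (simp add: conj_reflect_def reflect_poly_mult)

lemma degree_conj_reflect_le: "degree (conj_reflect p) \<le> degree p"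
  by (simp add: conj_reflect_def degree_map_poly degree_reflect_poly_le)

text \<open>With \<open>\<Phi>\<^sup>* = conj_reflect \<Phi>\<close>, a zero of \<open>\<Phi>\<close> outside the open disc prevents some
  \<open>\<lambda> z \<Phi> + cnj \<lambda> \<Phi>\<^sup>*\<close> from having only simple zeros on the unit circle: it vanishes at \<open>\<zeta>\<close> and
  at the mirror image of \<open>\<zeta>\<close>, doubly if \<open>\<zeta>\<close> is on the circle. For a zero \<open>z0\<close> in the exterior,
  \<open>\<zeta>\<close> is a point of the segment from 0 to the mirror image of \<open>z0\<close> where
  \<open>\<bar>z \<Phi> z\<bar> = \<bar>\<Phi>\<^sup>* z\<bar>\<close>.\<close>
lemma mirror_zeros:
  assumes monic: "lead_coeff \<Phi> = 1" and z0: "poly \<Phi> z0 = 0" "1 \<le> cmod z0"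
  shows "\<exists>l \<zeta> S. l \<noteq> 0 \<and> \<zeta> \<noteq> 0 \<and>
     Polynomial.smult l (pCons 0 \<Phi>) + Polynomial.smult (cnj l) (conj_reflect \<Phi>) = [:-\<zeta>, 1:] * [:1, -cnj \<zeta>:] * S"
proof (cases "cmod z0 = 1")
  case True
  then have z0_cnj: "z0 * cnj z0 = 1" by (simp add: complex_norm_square[symmetric])
  then have z0_inv: "inverse (cnj z0) = z0" by (metis inverse_unique mult.commute)
  have "z0 \<noteq> 0" using True by auto
  obtain Q where Q: "\<Phi> = [:-z0, 1:] * Q" using z0(1) by (metis dvdE poly_eq_0_iff_dvd)
  \<comment> \<open>On the circle the factor of \<open>z0\<close> is its own reversal up to a
    constant, so \<open>z0\<close> is a zero of both summands for every \<open>l\<close>. The choice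
    of \<open>l\<close> serves to make it a double zero.\<close>
  have refl_lin: "conj_reflect [:-z0, 1:] = Polynomial.smult (- cnj z0) [:-z0, 1:]"
    using z0_cnj by (simp add: conj_reflect_def reflect_poly_def map_poly_pCons mult.commute)
  define A where "A = z0 * poly Q z0"
  define B where "B = - cnj z0 * poly (conj_reflect Q) z0"
  have "cmod A = cmod B" unfolding A_def B_def
    using True \<open>z0 \<noteq> 0\<close> by (simp add: poly_conj_reflect z0_inv norm_mult norm_power)
  then obtain l where l: "l \<noteq> 0" "l * A + cnj l * B = 0" using unimodular_balance by blast
  define R where "R = Polynomial.smult l (pCons 0 Q) + Polynomial.smult (- cnj l * cnj z0) (conj_reflect Q)"
  have "poly R z0 = 0" using l(2) by (simp add: R_def A_def B_def algebra_simps)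
  then obtain S where S: "R = [:-z0, 1:] * S" by (metis dvdE poly_eq_0_iff_dvd)
  have "Polynomial.smult l (pCons 0 \<Phi>) + Polynomial.smult (cnj l) (conj_reflect \<Phi>) = [:-z0, 1:] * R"
  proof (rule poly_eq_poly_eq_iff[THEN iffD1], rule ext)
    fix z
    show "poly (Polynomial.smult l (pCons 0 \<Phi>) + Polynomial.smult (cnj l) (conj_reflect \<Phi>)) z = poly ([:-z0, 1:] * R) z"
      unfolding Q conj_reflect_mult refl_lin R_def by (simp add: algebra_simps)
  qed
  also have "\<dots> = [:-z0, 1:] * [:1, -cnj z0:] * Polynomial.smult (- z0) S"
  proof -
    have "Polynomial.smult (- z0) [:1, -cnj z0:] = [:-z0, 1:]" using z0_cnj by simp
    then show ?thesis unfolding S by (metis mult.assoc mult_smult_left mult_smult_right)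
  qed
  finally show ?thesis using l(1) \<open>z0 \<noteq> 0\<close> by blast
next
  case False
  then have gt: "1 < cmod z0" using z0(2) by simp
  define w where "w = inverse (cnj z0)"
  have w: "w \<noteq> 0" "cmod w < 1" "inverse (cnj w) = z0"
    using gt by (auto simp: w_def norm_inverse inverse_less_1_iff)
  let ?\<Psi> = "conj_reflect \<Phi>"
  let ?f = "\<lambda>t::real. cmod (poly ?\<Psi> (of_real t * w)) - cmod (of_real t * w * poly \<Phi> (of_real t * w))"
  \<comment> \<open>At \<open>t = 1\<close> the reversed polynomial vanishes, since \<open>w\<close>
    is the mirror image of the zero \<open>z0\<close>; at \<open>t = 0\<close> the second modulus
    vanishes because of the factor \<open>w\<close> times \<open>t\<close>.\<close>
  have "\<exists>t\<ge>0. t \<le> 1 \<and> ?f t = 0"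
  proof (rule IVT2')
    show "?f 1 \<le> 0" using w z0(1) by (simp add: poly_conj_reflect)
    show "0 \<le> ?f 0" by simp
    show "continuous_on {0..1} ?f" by (intro continuous_intros)
  qed simp
  then obtain t where t: "0 \<le> t" "t \<le> 1" "?f t = 0" by blast
  define \<zeta> where "\<zeta> = of_real t * w"
  have "t * cmod w \<le> 1 * cmod w" using t(2) by (intro mult_right_mono) auto
  then have "cmod \<zeta> < 1" using t(1) w(2) by (simp add: \<zeta>_def norm_mult)
  have "cmod (\<zeta> * poly \<Phi> \<zeta>) = cmod (poly ?\<Psi> \<zeta>)" using t(3) by (simp add: \<zeta>_def)
  then obtain l where l: "l \<noteq> 0" "l * (\<zeta> * poly \<Phi> \<zeta>) + cnj l * poly ?\<Psi> \<zeta> = 0"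
    using unimodular_balance by blast
  define P where "P = Polynomial.smult l (pCons 0 \<Phi>) + Polynomial.smult (cnj l) ?\<Psi>"
  have P\<zeta>: "poly P \<zeta> = 0" using l(2) by (simp add: P_def mult.left_commute)
  \<comment> \<open>Monicity enters here: it keeps \<open>\<zeta>\<close> away from 0, so that its
    mirror image \<open>v\<close> is a finite point.\<close>
  have "poly P 0 = cnj l" using monic by (simp add: P_def poly_conj_reflect_0)
  then have "\<zeta> \<noteq> 0" using P\<zeta> l(1) by auto
  define v where "v = inverse (cnj \<zeta>)"
  have v: "v \<noteq> 0" "inverse (cnj v) = \<zeta>" "v * cnj \<zeta> = 1" using \<open>\<zeta> \<noteq> 0\<close> by (auto simp: v_def)
  \<comment> \<open>The combination is self-reciprocal with respect to the exponent
    \<open>degree \<Phi> + 1\<close>: reversal exchanges its two summands. Zeros therefore come in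
    mirror pairs.\<close>
  have "poly P v = v ^ Suc (degree \<Phi>) * cnj (poly P \<zeta>)"
  proof -
    have "poly ?\<Psi> v = v ^ degree \<Phi> * cnj (poly \<Phi> \<zeta>)" using v by (simp add: poly_conj_reflect)
    moreover have "v ^ degree \<Phi> * cnj (poly ?\<Psi> \<zeta>) = (v * cnj \<zeta>) ^ degree \<Phi> * poly \<Phi> v"
      using \<open>\<zeta> \<noteq> 0\<close> by (simp add: poly_conj_reflect v_def flip: power_mult_distrib)
    moreover have "v ^ Suc (degree \<Phi>) * cnj (poly P \<zeta>)
       = l * v * (v ^ degree \<Phi> * cnj (poly ?\<Psi> \<zeta>)) + cnj l * (v * cnj \<zeta>) * (v ^ degree \<Phi> * cnj (poly \<Phi> \<zeta>))"
      by (simp add: P_def algebra_simps)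
    ultimately show ?thesis using v(3) by (simp add: P_def)
  qed
  then have Pv: "poly P v = 0" using P\<zeta> by simp
  have "v \<noteq> \<zeta>"
  proof
    assume "v = \<zeta>"
    then have "\<zeta> * cnj \<zeta> = 1" using v(3) by simp
    then have "cmod \<zeta> ^ 2 = 1" by (metis complex_norm_square of_real_eq_1_iff)
    then show False using \<open>cmod \<zeta> < 1\<close> norm_ge_zero[of \<zeta>] by (auto simp: power2_eq_1_iff)
  qed
  obtain P1 where P1: "P = [:-\<zeta>, 1:] * P1" using P\<zeta> by (metis dvdE poly_eq_0_iff_dvd)
  then have "poly P1 v = 0" using Pv \<open>v \<noteq> \<zeta>\<close> by simp
  then obtain S where S: "P1 = [:-v, 1:] * S" by (metis dvdE poly_eq_0_iff_dvd)
  have "Polynomial.smult (- v) [:1, -cnj \<zeta>:] = [:-v, 1:]" using v(3) by simp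
  then have "P = [:-\<zeta>, 1:] * [:1, -cnj \<zeta>:] * Polynomial.smult (- v) S"
    unfolding P1 S by (metis mult.assoc mult_smult_left mult_smult_right)
  then show ?thesis unfolding P_def using l(1) \<open>\<zeta> \<noteq> 0\<close> by blast
qed

text \<open>On the circle,
  \<open>cis (- (real M * \<theta> / 2)) * poly \<Phi> (cis \<theta>)\<close> is the function
  \<open>\<phi>\<close> times a square root of \<open>z\<close>. Twice the real part of its multiple
  by \<open>l\<close> is the combination of \<open>mirror_zeros\<close> times a half-integer power,
  and \<open>(z - \<zeta>) (1 - cnj \<zeta> z)\<close> is \<open>z\<close> times a squared distance.
  The cofactor loses two of the \<open>M + 2\<close> degrees.\<close>

lemma real_part_factorization:
  assumes monic: "lead_coeff \<Phi> = 1" and z0: "poly \<Phi> z0 = 0" "1 \<le> cmod z0"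
    and N: "degree \<Phi> = Suc M"
  obtains l \<zeta> g where "trig_poly M (\<lambda>\<theta>. complex_of_real (g \<theta>))" "\<exists>\<theta>. g \<theta> \<noteq> 0"
    "\<And>\<theta>. Re (l * (cis (- (real M * \<theta> / 2)) * poly \<Phi> (cis \<theta>))) = (cmod (cis \<theta> - \<zeta>))\<^sup>2 * g \<theta>"
proof -
  obtain l \<zeta> S where l: "l \<noteq> 0" and "\<zeta> \<noteq> 0" and
    eq: "Polynomial.smult l (pCons 0 \<Phi>) + Polynomial.smult (cnj l) (conj_reflect \<Phi>)
      = [:-\<zeta>, 1:] * [:1, -cnj \<zeta>:] * S" (is "?P = _")
    using mirror_zeros[OF monic z0] by blast
  \<comment> \<open>The coefficient of order \<open>M + 2\<close> comes from \<open>z \<Phi>\<close>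
    alone and equals \<open>l\<close>, so the combination is not the zero polynomial.\<close>
  have "coeff (conj_reflect \<Phi>) (Suc (Suc M)) = 0"
    using degree_conj_reflect_le[of \<Phi>] N by (intro coeff_eq_0) simp
  then have "coeff ?P (Suc (Suc M)) = l" using monic N by simp
  then have "?P \<noteq> 0" using l by (metis coeff_0)
  have "degree ?P \<le> Suc (Suc M)"
  proof (rule degree_add_le)
    show "degree (Polynomial.smult l (pCons 0 \<Phi>)) \<le> Suc (Suc M)" using N degree_pCons_le[of 0 \<Phi>] by simp
    show "degree (Polynomial.smult (cnj l) (conj_reflect \<Phi>)) \<le> Suc (Suc M)" using N degree_conj_reflect_le[of \<Phi>] by simp
  qed
  moreover have "degree ?P = 2 + degree S"
  proof -
    have "S \<noteq> 0" using eq \<open>?P \<noteq> 0\<close> by auto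
    moreover have "degree ([:-\<zeta>, 1:] * [:1, -cnj \<zeta>:]) = 2" "[:-\<zeta>, 1:] * [:1, -cnj \<zeta>:] \<noteq> 0"
      using \<open>\<zeta> \<noteq> 0\<close> by simp_all
    ultimately show ?thesis unfolding eq by (metis degree_mult_eq)
  qed
  ultimately have degS: "degree S \<le> M" by simp
  define s where "s \<theta> = cis (- (real M * \<theta> / 2)) * poly S (cis \<theta>)" for \<theta>
  define X where "X \<theta> = l * (cis (- (real M * \<theta> / 2)) * poly \<Phi> (cis \<theta>))" for \<theta>
  have X: "X \<theta> + cnj (X \<theta>) = cis (- (real (Suc (Suc M)) * \<theta> / 2)) * poly ?P (cis \<theta>)" for \<theta>
  proof -
    have 1: "cis (- (real M * \<theta> / 2)) = cis (- (real (Suc (Suc M)) * \<theta> / 2)) * cis \<theta>"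
      unfolding cis_mult by (rule arg_cong[of _ _ cis]) (simp add: field_simps)
    have "cnj (X \<theta>) = cnj l * (cis (real M * \<theta> / 2) * cnj (poly \<Phi> (cis \<theta>)))"
      by (simp add: X_def cis_cnj)
    also have "cis (real M * \<theta> / 2) = cis (- (real (Suc (Suc M)) * \<theta> / 2)) * cis \<theta> ^ Suc M"
      unfolding Complex.DeMoivre cis_mult by (rule arg_cong[of _ _ cis]) (simp add: field_simps)
    also have "cis (- (real (Suc (Suc M)) * \<theta> / 2)) * cis \<theta> ^ Suc M * cnj (poly \<Phi> (cis \<theta>))
        = cis (- (real (Suc (Suc M)) * \<theta> / 2)) * poly (conj_reflect \<Phi>) (cis \<theta>)"
      by (subst poly_conj_reflect) (simp_all add: N cis_cnj)
    finally show ?thesis unfolding X_def 1 by (simp add: algebra_simps)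
  qed
  have fact: "cis (- (real (Suc (Suc M)) * \<theta> / 2)) * poly ?P (cis \<theta>)
      = of_real ((cmod (cis \<theta> - \<zeta>))\<^sup>2) * s \<theta>" for \<theta>
  proof -
    have 1: "cis (- (real M * \<theta> / 2)) = cis (- (real (Suc (Suc M)) * \<theta> / 2)) * cis \<theta>"
      unfolding cis_mult by (rule arg_cong[of _ _ cis]) (simp add: field_simps)
    have "cis \<theta> * cnj (cis \<theta>) = 1" by (simp add: cis_cnj cis_mult)
    then have "(cis \<theta> - \<zeta>) * (1 - cnj \<zeta> * cis \<theta>) = cis \<theta> * ((cis \<theta> - \<zeta>) * cnj (cis \<theta> - \<zeta>))"
      by (simp add: algebra_simps)
    also have "(cis \<theta> - \<zeta>) * cnj (cis \<theta> - \<zeta>) = of_real ((cmod (cis \<theta> - \<zeta>))\<^sup>2)"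
      by (rule complex_norm_square[symmetric])
    finally have 2: "(cis \<theta> - \<zeta>) * (1 - cnj \<zeta> * cis \<theta>) = cis \<theta> * of_real ((cmod (cis \<theta> - \<zeta>))\<^sup>2)" .
    have "poly ?P (cis \<theta>) = (cis \<theta> - \<zeta>) * (1 - cnj \<zeta> * cis \<theta>) * poly S (cis \<theta>)"
      unfolding eq by (simp add: algebra_simps)
    then show ?thesis unfolding s_def 1 2 by (simp add: mult_ac)
  qed
  have re: "2 * Re (X \<theta>) = (cmod (cis \<theta> - \<zeta>))\<^sup>2 * Re (s \<theta>)" for \<theta>
  proof -
    have "2 * Re (X \<theta>) = Re (X \<theta> + cnj (X \<theta>))" by simp
    also have "\<dots> = (cmod (cis \<theta> - \<zeta>))\<^sup>2 * Re (s \<theta>)" unfolding X fact by simp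
    finally show ?thesis .
  qed
  show ?thesis
  \<comment> \<open>Taking the real part of \<open>s\<close> makes \<open>g\<close> real by
    construction; the factor 1/2 stems from \<open>X + cnj X = 2 Re X\<close>.\<close>
  proof (rule that[of "\<lambda>\<theta>. Re (s \<theta>) / 2" l \<zeta>])
    have "trig_poly M s" unfolding trig_poly_def s_def using degS by blast
    from trig_poly_cmult[OF trig_poly_Re[OF this], of "1 / 2"]
    show "trig_poly M (\<lambda>\<theta>. complex_of_real (Re (s \<theta>) / 2))" by simp
    show "\<exists>\<theta>. Re (s \<theta>) / 2 \<noteq> 0"
    proof (rule ccontr)
      assume "\<not> ?thesis"
      then have "Re (X \<theta>) = 0" for \<theta> using re[of \<theta>] by simp
      then have "X \<theta> + cnj (X \<theta>) = 0" for \<theta> by (simp add: complex_add_cnj)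
      then have "poly ?P (cis \<theta>) = 0" for \<theta> using X[of \<theta>] by simp
      \<comment> \<open>If \<open>g\<close> vanished identically, the combination would vanish on
        the whole circle, which is infinite.\<close>
      then have "cis ` {0..<0 + 2 * pi} \<subseteq> {z. poly ?P z = 0}" by blast
      moreover have "infinite (cis ` {0..<0 + 2 * pi})"
        using finite_imageD[OF _ inj_on_cis[of 0]] infinite_Ico[of 0 "2 * pi"] by auto
      ultimately show False using poly_roots_finite[OF \<open>?P \<noteq> 0\<close>] finite_subset by blast
    qed
    show "Re (l * (cis (- (real M * \<theta> / 2)) * poly \<Phi> (cis \<theta>))) = (cmod (cis \<theta> - \<zeta>))\<^sup>2 * (Re (s \<theta>) / 2)" for \<theta>
      using re[of \<theta>] by (simp add: X_def)
  qed
qed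

section \<open>Measures on the circle\<close>

lemma Arg_measurable [measurable]: "Arg \<in> borel_measurable borel"
proof -
  have "Arg = (\<lambda>z. if z = 0 then 0 else Im (Ln z))"
    by (auto simp: fun_eq_iff Arg_zero Arg_eq_Im_Ln)
  also have "\<dots> \<in> borel_measurable borel" by measurable
  finally show ?thesis .
qed

lemma arg_from_measurable [measurable]: "arg_from t \<in> borel_measurable borel"
  unfolding arg_from_def frac_def by measurable

lemma arg_from_bounds: "arg_from t z \<in> {t..<t + 2 * pi}"
  unfolding arg_from_def using frac_lt_1[of "(Arg z - t) / (2 * pi)"] by simp

lemma cis_arg_from:
  assumes "cmod z = 1"
  shows "cis (arg_from t z) = z"
proof -
  define k where "k = \<lfloor>(Arg z - t) / (2 * pi)\<rfloor>"
  have "arg_from t z = Arg z - 2 * pi * k"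
    unfolding arg_from_def frac_def k_def by (simp add: field_simps)
  then have "cis (arg_from t z) = cis (Arg z)"
    using sin_cos_eq_iff[of "Arg z" "Arg z - 2 * pi * k"] by (auto simp: complex_eq_iff)
  also have "\<dots> = z" using assms by (subst cis_Arg) (auto simp: sgn_div_norm)
  finally show ?thesis .
qed

lemma arg_from_cis: "\<theta> \<in> {t..<t + 2 * pi} \<Longrightarrow> arg_from t (cis \<theta>) = \<theta>"
  using inj_onD[OF inj_on_cis[of t] cis_arg_from[of "cis \<theta>" t] arg_from_bounds] by simp

lemma hpow_circle: "cmod z = 1 \<Longrightarrow> hpow t k z = cis (real_of_int k * arg_from t z / 2)"
  by (simp add: hpow_def)

text \<open>By second countability the complement of the support is covered by countably many basic
  open sets of measure zero.\<close>

lemma AE_msupp: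
  assumes "sets M = sets borel"
  shows "AE z in M. z \<in> msupp M"
proof -
  obtain B :: "complex set set" where B: "countable B" "topological_basis B"
    using ex_countable_basis by blast
  have "(\<Union>b\<in>{b\<in>B. emeasure M b = 0}. b) \<in> null_sets M"
  proof (rule null_sets_UN')
    fix b assume "b \<in> {b\<in>B. emeasure M b = 0}"
    then show "b \<in> null_sets M"
      using topological_basis_open[OF B(2)] assms by (auto simp: null_sets_def)
  qed (use B(1) in auto)
  then have "AE z in M. z \<notin> (\<Union>b\<in>{b\<in>B. emeasure M b = 0}. b)" by (rule AE_not_in)
  then show ?thesis
  proof eventually_elim
    case (elim z)
    show ?case
    proof (rule ccontr)
      assume "z \<notin> msupp M"
      then obtain e where e: "e > 0" "emeasure M (ball z e) = 0" by (auto simp: msupp_def)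
      obtain b where b: "b \<in> B" "z \<in> b" "b \<subseteq> ball z e"
        using topological_basisE[OF B(2), of "ball z e" z] e(1) by auto
      have "emeasure M b \<le> emeasure M (ball z e)"
        using b(3) assms by (intro emeasure_mono) auto
      then show False using elim b e(2) by auto
    qed
  qed
qed

lemma AE_circle: "circle_measure M \<Longrightarrow> AE z in M. cmod z = 1"
proof -
  assume M: "circle_measure M"
  then have "- sphere 0 1 \<in> null_sets M" by (auto simp: circle_measure_def null_sets_def)
  then have "AE z in M. z \<notin> - sphere 0 1" by (rule AE_not_in)
  then show ?thesis by eventually_elim simp
qed

text \<open>An infinite support contains a point off \<open>F\<close>, and a small ball around it
  misses \<open>F\<close> but has positive measure.\<close>

lemma circle_measure_not_finite:
  assumes M: "circle_measure M" and "finite F"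
  shows "\<not> (AE z in M. z \<in> F)"
proof
  assume ae: "AE z in M. z \<in> F"
  have "msupp M - F \<noteq> {}"
    using M \<open>finite F\<close> by (metis Diff_infinite_finite circle_measure_def infinite_imp_nonempty)
  then obtain z where z: "z \<in> msupp M" "z \<notin> F" by blast
  obtain e where e: "e > 0" "ball z e \<subseteq> - F"
    using z(2) finite_imp_closed[OF \<open>finite F\<close>] open_contains_ball[of "- F"] by auto
  have "AE z' in M. z' \<notin> ball z e" using ae by eventually_elim (use e(2) in auto)
  then have "emeasure M (ball z e) = 0"
    using AE_iff_null_sets[of "ball z e" M] M by (auto simp: circle_measure_def null_sets_def)
  then show False using z(1) e(1) by (auto simp: msupp_def)
qed

text \<open>Moving to the line provides the order needed for sign changes, and makes the chosen
  branch of half-integer powers an ordinary function of the angle.\<close>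

abbreviation angle_measure :: "real \<Rightarrow> complex measure \<Rightarrow> real measure" where
  "angle_measure t M \<equiv> distr M borel (arg_from t)"

lemma arg_from_measurable_circle:
  "circle_measure M \<Longrightarrow> arg_from t \<in> measurable M borel"
  using arg_from_measurable measurable_cong_sets[of M borel borel borel] by (auto simp: circle_measure_def)

lemma finite_angle_measure: "circle_measure M \<Longrightarrow> finite_measure (angle_measure t M)"
  using finite_measure.finite_measure_distr[OF _ arg_from_measurable_circle]
  by (simp add: circle_measure_def)

lemma AE_angle_measure:
  assumes M: "circle_measure M" and P: "{x. P x} \<in> sets borel"
  shows "(AE x in angle_measure t M. P x) \<longleftrightarrow> (AE z in M. P (arg_from t z))"
  by (rule AE_distr_iff[OF arg_from_measurable_circle[OF M]]) (use P in simp)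

lemma AE_angle_measure_bounds:
  assumes M: "circle_measure M"
  shows "AE x in angle_measure t M. x \<in> {t..<t + 2 * pi}"
  using arg_from_bounds by (subst AE_angle_measure[OF M]) auto

lemma angle_measure_not_finite:
  assumes M: "circle_measure M" and "finite F"
  shows "\<not> (AE x in angle_measure t M. x \<in> F)"
proof
  assume "AE x in angle_measure t M. x \<in> F"
  then have "AE z in M. arg_from t z \<in> F"
    using AE_angle_measure[OF M, of "\<lambda>x. x \<in> F" t] finite_imp_closed[OF \<open>finite F\<close>]
    by (simp add: borel_closed)
  with AE_circle[OF M] have "AE z in M. z \<in> cis ` F"
    by eventually_elim (metis cis_arg_from image_eqI)
  then show False using circle_measure_not_finite[OF M, of "cis ` F"] \<open>finite F\<close> by simp
qed

section \<open>Integrability and orthogonality in terms of angles\<close>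

lemma integrable_continuous_finite_measure:
  fixes f :: "real \<Rightarrow> 'b::{banach, second_countable_topology}"
  assumes K: "finite_measure K" "sets K = sets borel" and ae: "AE x in K. x \<in> {a..b}"
    and f: "continuous_on UNIV f"
  shows "integrable K f"
proof -
  have "compact (f ` {a..b})"
    by (intro compact_continuous_image continuous_on_subset[OF f]) auto
  then obtain B where "\<forall>x\<in>{a..b}. norm (f x) \<le> B" using compact_imp_bounded bounded_iff by (metis imageI)
  then have "AE x in K. norm (f x) \<le> B" using ae by (auto elim: eventually_mono)
  moreover have "f \<in> borel_measurable K"
    using borel_measurable_continuous_onI[OF f] measurable_cong_sets[OF K(2) refl] by blast
  ultimately show ?thesis by (rule finite_measure.integrable_const_bound[OF K(1)])
qed

lemma AE_angle_measure_cbox: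
  assumes M: "circle_measure M"
  shows "AE x in angle_measure t M. x \<in> {t..t + 2 * pi}"
  using AE_angle_measure_bounds[OF M] by eventually_elim simp

text \<open>Half a power of \<open>z\<close> is moved from the test function to
  \<open>\<phi>\<close>. The exponents \<open>-p\<close> run from \<open>m/2\<close> down to
  \<open>1 - m/2\<close>; lowered by 1/2 they fill the symmetric range from \<open>(m - 1)/2\<close>
  to \<open>-(m - 1)/2\<close>, the spectrum of \<open>trig_poly (m - 1)\<close>.\<close>

lemma orth_trig_poly:
  assumes M: "circle_measure M"
    and orth: "\<And>i. i < m \<Longrightarrow> (\<integral>z. phi_fun t (Suc N) c z * hpow t (- (2 * int i - int m)) z \<partial>M) = 0"
    and m: "0 < m" and \<tau>: "trig_poly (m - 1) \<tau>"
  shows "(\<integral>\<theta>. (cis (- (real N * \<theta> / 2)) * (\<Sum>k\<le>Suc N. c k * cis \<theta> ^ k)) * \<tau> \<theta> \<partial>angle_measure t M) = 0"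
proof -
  define F where "F \<theta> = cis (- (real N * \<theta> / 2)) * (\<Sum>k\<le>Suc N. c k * cis \<theta> ^ k)" for \<theta>
  have F: "continuous_on UNIV F"
    unfolding F_def by (intro continuous_intros continuous_on_cis) auto
  define e where "e k \<theta> = cis ((2 * real k - real (m - 1)) / 2 * \<theta>)" for k \<theta>
  have e: "continuous_on UNIV (e k)" for k
    unfolding e_def by (intro continuous_intros continuous_on_cis)
  obtain p where p: "degree p \<le> m - 1" "\<And>\<theta>. \<tau> \<theta> = cis (- (real (m - 1) * \<theta> / 2)) * poly p (cis \<theta>)"
    using \<tau> unfolding trig_poly_def by blast
  have \<tau>_eq: "\<tau> \<theta> = (\<Sum>k\<le>m - 1. coeff p k * e k \<theta>)" for \<theta>
  proof -
    have "\<tau> \<theta> = cis (- (real (m - 1) * \<theta> / 2)) * (\<Sum>k\<le>m - 1. coeff p k * cis \<theta> ^ k)"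
      unfolding p(2) using arg_cong[OF poly_as_sum_of_monoms'[OF p(1)], of "\<lambda>p. poly p (cis \<theta>)"]
      by (simp add: poly_sum poly_monom)
    also have "\<dots> = (\<Sum>k\<le>m - 1. coeff p k * (cis (- (real (m - 1) * \<theta> / 2)) * cis \<theta> ^ k))"
      by (simp add: sum_distrib_left mult.left_commute)
    finally show ?thesis unfolding e_def cis_half_shift .
  qed
  have int: "integrable (angle_measure t M) (\<lambda>\<theta>. F \<theta> * e k \<theta>)" for k
    by (rule integrable_continuous_finite_measure[OF finite_angle_measure[OF M] _ AE_angle_measure_cbox[OF M]])
      (use F e in \<open>auto intro: continuous_on_mult\<close>)
  have zero: "(\<integral>\<theta>. F \<theta> * e k \<theta> \<partial>angle_measure t M) = 0" if k: "k \<le> m - 1" for k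
  proof -
    \<comment> \<open>The orthogonality conditions list the frequencies in decreasing order, hence
      the reversed index.\<close>
    define i where "i = m - 1 - k"
    have i: "i < m" "real k = real m - 1 - real i" using m k by (auto simp: i_def of_nat_diff)
    have "(\<integral>\<theta>. F \<theta> * e k \<theta> \<partial>angle_measure t M) = (\<integral>z. F (arg_from t z) * e k (arg_from t z) \<partial>M)"
      by (rule integral_distr[OF arg_from_measurable_circle[OF M]])
        (use F e in \<open>auto intro!: borel_measurable_continuous_onI continuous_on_mult\<close>)
    also have "\<dots> = (\<integral>z. phi_fun t (Suc N) c z * hpow t (- (2 * int i - int m)) z \<partial>M)"
    proof (rule Bochner_Integration.integral_cong_AE)
      show "AE z in M. F (arg_from t z) * e k (arg_from t z)
          = phi_fun t (Suc N) c z * hpow t (- (2 * int i - int m)) z"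
        using AE_circle[OF M]
      proof eventually_elim
        case (elim z)
        define \<theta> where "\<theta> = arg_from t z"
        have "phi_fun t (Suc N) c z = (\<Sum>k\<le>Suc N. c k * cis ((2 * real k - real (Suc N)) / 2 * \<theta>))"
          unfolding phi_fun_def hpow_circle[OF elim] \<theta>_def by (intro sum.cong) (auto simp: algebra_simps)
        also have "\<dots> = (\<Sum>k\<le>Suc N. c k * (cis (- (real (Suc N) * \<theta> / 2)) * cis \<theta> ^ k))"
          unfolding cis_half_shift ..
        also have "\<dots> = cis (- (real (Suc N) * \<theta> / 2)) * (\<Sum>k\<le>Suc N. c k * cis \<theta> ^ k)"
          by (simp only: sum_distrib_left mult.left_commute)
        finally have 1: "phi_fun t (Suc N) c z = \<dots>" .
        have 2: "hpow t (- (2 * int i - int m)) z = cis ((real m - 2 * real i) * \<theta> / 2)"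
          unfolding hpow_circle[OF elim] \<theta>_def by simp
        have 3: "cis (- (real N * \<theta> / 2)) * e k \<theta> = cis (- (real (Suc N) * \<theta> / 2)) * cis ((real m - 2 * real i) * \<theta> / 2)"
          unfolding e_def cis_mult using m
          by (intro arg_cong[of _ _ cis]) (simp add: i(2) of_nat_diff field_simps)
        have "F \<theta> * e k \<theta> = (cis (- (real N * \<theta> / 2)) * e k \<theta>) * (\<Sum>k\<le>Suc N. c k * cis \<theta> ^ k)"
          by (simp only: F_def mult_ac)
        then show ?case unfolding 1 2 3 \<theta>_def[symmetric] by (simp only: mult_ac)
      qed
      have [measurable]: "F \<in> borel_measurable borel" "e k \<in> borel_measurable borel"
        using F e by (auto intro: borel_measurable_continuous_onI)
      have M': "borel_measurable M = borel_measurable borel"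
        using M by (intro measurable_cong_sets) (auto simp: circle_measure_def)
      show "(\<lambda>z. F (arg_from t z) * e k (arg_from t z)) \<in> borel_measurable M"
        unfolding M' by measurable
      have [measurable]: "(\<lambda>z. hpow t k z) \<in> borel_measurable borel" for k
      proof -
        have "cis \<in> borel_measurable borel"
          by (intro borel_measurable_continuous_onI continuous_on_cis continuous_on_id)
        then show ?thesis unfolding hpow_def by measurable
      qed
      show "(\<lambda>z. phi_fun t (Suc N) c z * hpow t (- (2 * int i - int m)) z) \<in> borel_measurable M"
        unfolding M' phi_fun_def by measurable
    qed
    also have "\<dots> = 0" by (rule orth[OF i(1)])
    finally show ?thesis .
  qed
  have "(\<integral>\<theta>. F \<theta> * \<tau> \<theta> \<partial>angle_measure t M)
      = (\<integral>\<theta>. (\<Sum>k\<le>m - 1. coeff p k * (F \<theta> * e k \<theta>)) \<partial>angle_measure t M)"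
    unfolding \<tau>_eq by (simp only: sum_distrib_left mult_ac)
  also have "\<dots> = (\<Sum>k\<le>m - 1. coeff p k * (\<integral>\<theta>. F \<theta> * e k \<theta> \<partial>angle_measure t M))"
    using int by (subst Bochner_Integration.integral_sum) auto
  also have "\<dots> = 0" using zero by simp
  finally show ?thesis unfolding F_def .
qed

text \<open>Orthogonality passes to the real part of a multiple of the complex function because the
  test function is real. \<open>G\<close> stands for that real part, so that its factored form can
  be inserted.\<close>

lemma orth_real_trig_poly:
  assumes M: "circle_measure M"
    and orth: "\<And>i. i < m \<Longrightarrow> (\<integral>z. phi_fun t (Suc N) c z * hpow t (- (2 * int i - int m)) z \<partial>M) = 0"
    and m: "0 < m" and \<tau>: "trig_poly (m - 1) (\<lambda>\<theta>. complex_of_real (\<tau> \<theta>))"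
    and G: "\<And>\<theta>. Re (l * (cis (- (real N * \<theta> / 2)) * (\<Sum>k\<le>Suc N. c k * cis \<theta> ^ k))) = G \<theta>"
  shows "(\<integral>\<theta>. \<tau> \<theta> * G \<theta> \<partial>angle_measure t M) = 0"
proof -
  define F where "F \<theta> = cis (- (real N * \<theta> / 2)) * (\<Sum>k\<le>Suc N. c k * cis \<theta> ^ k)" for \<theta>
  have F: "continuous_on UNIV F"
    unfolding F_def by (intro continuous_intros continuous_on_cis) auto
  have int: "integrable (angle_measure t M) (\<lambda>\<theta>. F \<theta> * complex_of_real (\<tau> \<theta>))"
    by (rule integrable_continuous_finite_measure[OF finite_angle_measure[OF M] _ AE_angle_measure_cbox[OF M]])
      (use F trig_poly_continuous[OF \<tau>] in \<open>auto intro: continuous_on_mult\<close>)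
  have "(\<integral>\<theta>. F \<theta> * complex_of_real (\<tau> \<theta>) \<partial>angle_measure t M) = 0"
    using orth_trig_poly[OF M orth m \<tau>] unfolding F_def by simp
  then have "0 = Re (\<integral>\<theta>. l * (F \<theta> * complex_of_real (\<tau> \<theta>)) \<partial>angle_measure t M)" by simp
  also have "\<dots> = (\<integral>\<theta>. Re (l * (F \<theta> * complex_of_real (\<tau> \<theta>))) \<partial>angle_measure t M)"
    using int by (intro integral_Re[symmetric] integrable_mult_right)
  also have "\<dots> = (\<integral>\<theta>. \<tau> \<theta> * G \<theta> \<partial>angle_measure t M)"
  proof (rule Bochner_Integration.integral_cong[OF refl])
    fix \<theta>
    have "l * (F \<theta> * complex_of_real (\<tau> \<theta>)) = complex_of_real (\<tau> \<theta>) * (l * F \<theta>)" by simp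
    then show "Re (l * (F \<theta> * complex_of_real (\<tau> \<theta>))) = \<tau> \<theta> * G \<theta>"
      unfolding G[symmetric] F_def[symmetric] by (metis Re_complex_of_real Im_complex_of_real complex.sel(1) times_complex.sel(1) mult_zero_left diff_zero)
  qed
  finally show ?thesis by simp
qed

text \<open>The nonnegative factor \<open>h\<close> is absorbed into the measure.\<close>
lemma chebyshev_system_not_orthogonal:
  fixes \<nu> :: "real measure" and u :: "nat \<Rightarrow> real \<Rightarrow> real" and g h :: "real \<Rightarrow> real"
  assumes \<nu>: "sets \<nu> = sets borel" "finite_measure \<nu>" "AE x in \<nu>. x \<in> J" "J \<subseteq> {a..b}"
    and inf: "\<And>F. finite F \<Longrightarrow> \<not> (AE x in \<nu>. x \<in> F)"
    and I: "is_interval I" "I \<subseteq> J" "AE x in \<nu>. x \<in> I \<or> g x = 0"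
    and h: "continuous_on UNIV h" "\<And>x. 0 \<le> h x" "finite {x\<in>J. h x = 0}"
    and g: "continuous_on UNIV g" "finite {x\<in>J. g x = 0}" "card {x\<in>I. g x = 0} < n"
    and u: "\<And>i. i < n \<Longrightarrow> continuous_on UNIV (u i)"
    and nz: "\<And>x. strict_mono_on {..<n} x \<Longrightarrow> x ` {..<n} \<subseteq> I \<Longrightarrow> det_fun n (\<lambda>i k. u i (x k)) \<noteq> 0"
  shows "\<exists>i<n. (\<integral>x. u i x * (h x * g x) \<partial>\<nu>) \<noteq> 0"
proof -
  have meas: "f \<in> borel_measurable \<nu>" if "continuous_on UNIV f" for f :: "real \<Rightarrow> real"
    using borel_measurable_continuous_onI[OF that] measurable_cong_sets[OF \<nu>(1) refl] by blast
  \<comment> \<open>With density \<open>h * \<bar>g\<bar>\<close>, integrating against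
    \<open>sgn g\<close> for \<open>K\<close> is integrating against \<open>h * g\<close> for
    \<open>\<nu>\<close>.\<close>
  let ?d = "\<lambda>x. h x * \<bar>g x\<bar>"
  have d_cont: "continuous_on UNIV ?d" by (intro continuous_intros h g)
  have d_pos: "?d x \<ge> 0" for x using h(2) by simp
  have ae_ab: "AE x in \<nu>. x \<in> {a..b}" using \<nu>(3) by eventually_elim (use \<nu>(4) in auto)
  define K where "K = density \<nu> ?d"
  have AE_K: "(AE x in K. P x) \<longleftrightarrow> (AE x in \<nu>. 0 < ?d x \<longrightarrow> P x)" for P
    unfolding K_def using meas[OF d_cont] by (subst AE_density) (auto simp: ennreal_less_zero_iff)
  have K_int: "integrable K f" "(\<integral>x. f x \<partial>K) = (\<integral>x. ?d x * f x \<partial>\<nu>)"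
    if "f \<in> borel_measurable \<nu>" "integrable \<nu> (\<lambda>x. ?d x * f x)" for f :: "real \<Rightarrow> real"
    unfolding K_def using that meas[OF d_cont] d_pos
    by (auto simp: integrable_density integral_density)
  have "\<exists>i<n. (\<integral>x. u i x * sgn (g x) \<partial>K) \<noteq> 0"
  proof (rule chebyshev_system_not_annihilated[of K I a b g n u])
    show "sets K = sets borel" unfolding K_def using \<nu>(1) by simp
    show "is_interval I" "I \<subseteq> {a..b}" using I \<nu>(4) by auto
    show "\<not> (AE x in K. x \<in> F)" if "finite F" for F
    proof
      assume "AE x in K. x \<in> F"
      then have "AE x in \<nu>. 0 < ?d x \<longrightarrow> x \<in> F" unfolding AE_K .
      \<comment> \<open>The density has only finitely many zeros in \<open>J\<close>, so a finite
        carrier of \<open>K\<close> would give one of \<open>\<nu>\<close>.\<close>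
      with \<nu>(3) have "AE x in \<nu>. x \<in> F \<union> {x\<in>J. h x = 0} \<union> {x\<in>J. g x = 0}"
      proof eventually_elim
        case (elim x)
        then show ?case using h(2)[of x] d_pos[of x] by (cases "h x = 0 \<or> g x = 0") auto
      qed
      then show False using inf[of "F \<union> {x\<in>J. h x = 0} \<union> {x\<in>J. g x = 0}"] that h(3) g(2) by simp
    qed
    show "AE x in K. x \<in> I" unfolding AE_K using I(3) by eventually_elim auto
    show "AE x in K. g x \<noteq> 0" unfolding AE_K by (intro AE_I2) auto
    show "g \<in> borel_measurable K" unfolding K_def using meas[OF g(1)] by simp
    show "continuous_on I g" "\<And>i. i < n \<Longrightarrow> continuous_on I (u i)"
      using continuous_on_subset[OF g(1)] continuous_on_subset[OF u] by auto
    show "finite {x\<in>I. g x = 0}" using g(2) by (rule finite_subset[rotated]) (use I(2) in auto)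
    show "integrable K (u i)" if "i < n" for i
      by (intro K_int meas u that integrable_continuous_finite_measure[OF \<nu>(2,1) ae_ab]
          continuous_on_mult d_cont)
  qed (use g(3) nz in auto)
  then obtain i where i: "i < n" "(\<integral>x. u i x * sgn (g x) \<partial>K) \<noteq> 0" by blast
  have sg: "?d x * (u i x * sgn (g x)) = u i x * (h x * g x)" for x
    by (simp add: abs_mult_sgn mult_ac)
  have "integrable \<nu> (\<lambda>x. u i x * (h x * g x))"
    by (intro integrable_continuous_finite_measure[OF \<nu>(2,1) ae_ab] continuous_on_mult u i h g)
  moreover have "(\<lambda>x. u i x * sgn (g x)) \<in> borel_measurable \<nu>"
    using meas[OF u[OF i(1)]] measurable_compose[OF meas[OF g(1)] borel_measurable_sgn]
    by (rule borel_measurable_times)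
  ultimately have "(\<integral>x. u i x * sgn (g x) \<partial>K) = (\<integral>x. u i x * (h x * g x) \<partial>\<nu>)"
    using K_int(2)[of "\<lambda>x. u i x * sgn (g x)"] unfolding sg by blast
  then show ?thesis using i by auto
qed

section \<open>Angelesco and AT systems\<close>

lemma det_fun_1: "det_fun 1 A \<noteq> 0 \<Longrightarrow> A 0 0 \<noteq> 0"
  unfolding det_fun_eq_0_iff by (auto dest!: spec[of _ "\<lambda>_. 1"])

lemma length_trig_list: "length (trig_list m f) = m"
proof (cases "even m")
  case True
  then obtain l where "m = 2 * l" by blast
  then show ?thesis by (simp add: trig_list_def length_concat o_def sum_list_triv del: upt_Suc)
next
  case False
  then obtain l where "m = 2 * l + 1" by (rule oddE)
  then show ?thesis by (simp add: trig_list_def length_concat o_def sum_list_triv del: upt_Suc)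
qed

lemma trig_poly_cos_sin:
  assumes "2 * real k - real m = 2 * q" "k \<le> m"
  shows "trig_poly m (\<lambda>\<theta>. complex_of_real (cos (q * \<theta>)))" "trig_poly m (\<lambda>\<theta>. complex_of_real (sin (q * \<theta>)))"
proof -
  have c: "trig_poly m (\<lambda>\<theta>. cis (q * \<theta>))" using trig_poly_cis[OF assms(2)] assms(1) by simp
  show "trig_poly m (\<lambda>\<theta>. complex_of_real (cos (q * \<theta>)))" using trig_poly_Re[OF c] by simp
  show "trig_poly m (\<lambda>\<theta>. complex_of_real (sin (q * \<theta>)))"
    using trig_poly_Re[OF trig_poly_cmult[OF c, of "- \<i>"]] by simp
qed

text \<open>The frequencies in the list are at most \<open>(m - 1)/2\<close> and differ from it by
  an integer, so every member is \<open>f\<close> times an admissible real test function.\<close>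

lemma trig_list_memb:
  assumes "u \<in> set (trig_list m f)"
  shows "0 < m \<and> (\<exists>\<tau>. trig_poly (m - 1) (\<lambda>\<theta>. complex_of_real (\<tau> \<theta>)) \<and> u = (\<lambda>\<theta>. f \<theta> * \<tau> \<theta>))"
proof (cases "even m")
  case True
  then obtain l where l: "m = 2 * l" by blast
  obtain k where k: "1 \<le> k" "k \<le> l" and u: "u = (\<lambda>\<theta>. f \<theta> * cos ((2 * real k - 1) / 2 * \<theta>)) \<or>
      u = (\<lambda>\<theta>. f \<theta> * sin ((2 * real k - 1) / 2 * \<theta>))"
    using assms unfolding trig_list_def by (auto simp: l less_Suc_eq_le)
  \<comment> \<open>The frequency \<open>(2 * k - 1) / 2\<close> sits at position
    \<open>k - 1 + l\<close> in the spectrum of \<open>trig_poly (2 * l - 1)\<close>.\<close>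
  have "2 * real (k - 1 + l) - real (m - 1) = 2 * ((2 * real k - 1) / 2)" "k - 1 + l \<le> m - 1"
    using k by (auto simp: l of_nat_diff)
  from trig_poly_cos_sin[OF this] show ?thesis using u k l by auto
next
  case False
  then obtain l where l: "m = Suc (2 * l)" by (auto elim: oddE)
  have "u = f \<or> (\<exists>k. k \<le> l \<and> (u = (\<lambda>\<theta>. f \<theta> * cos (real k * \<theta>)) \<or> u = (\<lambda>\<theta>. f \<theta> * sin (real k * \<theta>))))"
  proof -
    have "set (trig_list m f) = insert f (\<Union>k\<in>{1..<l + 1}.
        {\<lambda>\<theta>. f \<theta> * cos (real k * \<theta>), \<lambda>\<theta>. f \<theta> * sin (real k * \<theta>)})"
      by (simp add: trig_list_def l del: upt_Suc)
    then show ?thesis using assms by fastforce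
  qed
  then consider "u = (\<lambda>\<theta>. f \<theta> * cos (real 0 * \<theta>))"
    | k where "k \<le> l" "u = (\<lambda>\<theta>. f \<theta> * cos (real k * \<theta>)) \<or> u = (\<lambda>\<theta>. f \<theta> * sin (real k * \<theta>))"
    by auto
  then obtain k where k: "k \<le> l" and u: "u = (\<lambda>\<theta>. f \<theta> * cos (real k * \<theta>)) \<or> u = (\<lambda>\<theta>. f \<theta> * sin (real k * \<theta>))"
  proof cases
    case 1
    then show ?thesis using that[OF le0] by blast
  next
    case 2
    then show ?thesis using that by blast
  qed
  have "2 * real (k + l) - real (m - 1) = 2 * real k" "k + l \<le> m - 1" using k by (auto simp: l)
  from trig_poly_cos_sin[OF this] show ?thesis using u l by auto
qed

section \<open>Nonorthogonality for the two kinds of systems\<close>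

lemma finite_zeros_dist:
  "finite {x \<in> {t..<t + 2 * pi}. (cmod (cis x - \<zeta>))\<^sup>2 = 0}"
proof -
  have "finite (cis -` {\<zeta>} \<inter> {t..<t + 2 * pi})" by (rule finite_vimage_IntI[OF _ inj_on_cis]) simp
  then show ?thesis by (rule finite_subset[rotated]) auto
qed

lemma trig_poly_real_continuous:
  "trig_poly m (\<lambda>\<theta>. complex_of_real (g \<theta>)) \<Longrightarrow> continuous_on UNIV g"
  using continuous_on_Re[OF trig_poly_continuous] by fastforce

text \<open>Pigeonhole: \<open>g\<close> has at most \<open>M\<close> zeros in a period while the
  \<open>n j\<close> add up to \<open>M + 1\<close>, so some arc carries fewer than
  \<open>n j\<close> of them. There the half-angle basis of \<open>n j\<close> functions supplies
  the test function.\<close>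

lemma angelesco_no_orthogonal:
  assumes meas: "\<forall>j<r. circle_measure (\<mu> j)" and ang: "angelesco t r \<mu>"
    and N: "(\<Sum>j<r. n j) = Suc M" and g: "trig_poly M (\<lambda>\<theta>. complex_of_real (g \<theta>))" "g \<theta>\<^sub>0 \<noteq> 0"
  shows "\<exists>j<r. 0 < n j \<and> (\<exists>\<tau>. trig_poly (n j - 1) (\<lambda>\<theta>. complex_of_real (\<tau> \<theta>)) \<and>
    (\<integral>\<theta>. \<tau> \<theta> * ((cmod (cis \<theta> - \<zeta>))\<^sup>2 * g \<theta>) \<partial>angle_measure t (\<mu> j)) \<noteq> 0)"
proof -
  let ?J = "{t..<t + 2 * pi}"
  from ang obtain a b where A: "\<forall>k<r. a k \<le> b k \<and> msupp (\<mu> k) \<subseteq> arc (a k) (b k)"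
      "0 < r \<longrightarrow> t \<le> a 0 \<and> b (r - 1) \<le> t + 2 * pi" "\<forall>k. Suc k < r \<longrightarrow> b k \<le> a (Suc k)"
      "0 < r \<longrightarrow> emeasure (\<mu> (r - 1)) {cis t} = 0"
    unfolding angelesco_def by - (elim exE conjE, rule that)
  have ab: "a k \<le> b k" "msupp (\<mu> k) \<subseteq> arc (a k) (b k)" if "k < r" for k
    using A(1) that by auto
  have ends: "0 < r \<Longrightarrow> t \<le> a 0" "0 < r \<Longrightarrow> b (r - 1) \<le> t + 2 * pi" using A(2) by auto
  note step = A(3)[rule_format] and atom = A(4)[rule_format]
  have order: "b j \<le> a k" if "j < k" "k < r" for j k
    using that
  proof (induction k)
    case (Suc k)
    show ?case
    proof (cases "j = k")
      case True
      then show ?thesis using step Suc.prems by simp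
    next
      case False
      then have "b j \<le> a k" "a k \<le> b k" using Suc ab(1)[of k] by auto
      then show ?thesis using step[of k] Suc.prems by simp
    qed
  qed simp
  have low: "t \<le> a j" if "j < r" for j
    using that order[of 0 j] ends(1) ab(1)[of 0] by (cases "j = 0") auto
  have up: "b j \<le> t + 2 * pi" if "j < r" for j
  proof (cases "j = r - 1")
    case True
    then show ?thesis using that ends(2) by simp
  next
    case False
    then have "j < r - 1" "r - 1 < r" "0 < r" using that by auto
    then show ?thesis using order[of j "r - 1"] ends(2) ab(1)[of "r - 1"] by linarith
  qed
  \<comment> \<open>If an earlier arc reached \<open>t + 2 * pi\<close>, the last arc would shrink
    to a point and could not carry an infinite support.\<close>
  have up_less: "b j < t + 2 * pi" if "j < r - 1" for j
  proof (rule ccontr)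
    assume "\<not> ?thesis"
    moreover have "b j \<le> a (r - 1)" "a (r - 1) \<le> b (r - 1)" "b (r - 1) \<le> t + 2 * pi"
      using that order[of j "r - 1"] ab(1)[of "r - 1"] ends(2) by auto
    ultimately have "a (r - 1) = b (r - 1)" by linarith
    then have "msupp (\<mu> (r - 1)) \<subseteq> {cis (a (r - 1))}"
      using ab(2)[of "r - 1"] that by (auto simp: Defs.arc_def)
    then have "finite (msupp (\<mu> (r - 1)))" using finite_subset by blast
    then show False using meas that by (auto simp: circle_measure_def)
  qed
  have arcs: "AE x in angle_measure t (\<mu> j). x \<in> {a j..b j}" if j: "j < r" for j
  proof -
    have cm: "circle_measure (\<mu> j)" using meas j by blast
    have sets: "sets (\<mu> j) = sets borel" using cm by (simp add: circle_measure_def)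
    \<comment> \<open>The base point has angle \<open>t\<close> under \<open>arg_from\<close>,
      although an arc may contain it as \<open>t + 2 * pi\<close>. Only the last arc can do so, and
      its measure has no mass there.\<close>
    have "AE z in \<mu> j. z = cis t \<longrightarrow> b j < t + 2 * pi"
    proof (cases "j = r - 1")
      case True
      then have "{cis t} \<in> null_sets (\<mu> j)" using atom j sets by (auto simp: null_sets_def)
      then have "AE z in \<mu> j. z \<notin> {cis t}" by (rule AE_not_in)
      then show ?thesis by eventually_elim auto
    next
      case False
      then show ?thesis using up_less[of j] j by simp
    qed
    with AE_msupp[OF sets] have "AE z in \<mu> j. arg_from t z \<in> {a j..b j}"
    proof eventually_elim
      case (elim z)
      then obtain x where x: "x \<in> {a j..b j}" "z = cis x"
        using ab(2)[OF j] by (auto simp: Defs.arc_def)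
      have "cis (t + 2 * pi) = cis t" by (simp add: complex_eq_iff)
      then have "x \<noteq> t + 2 * pi" using elim(2) x by auto
      then have "x \<in> ?J" using x(1) low[OF j] up[OF j] by auto
      then show ?case using x arg_from_cis by simp
    qed
    then show ?thesis by (subst AE_angle_measure[OF cm]) auto
  qed
  \<comment> \<open>Zeros of \<open>g\<close> at the endpoints are left out, so that adjacent arcs share no zero.\<close>
  define I where "I j = {x \<in> ?J. a j \<le> x \<and> x \<le> b j \<and> ((x = a j \<or> x = b j) \<longrightarrow> g x \<noteq> 0)}" for j
  define Z where "Z j = {x \<in> I j. g x = 0}" for j
  have fin: "finite {x \<in> ?J. g x = 0}" and card: "card {x \<in> ?J. g x = 0} \<le> M"
    using trig_poly_zeros[OF g(1), of \<theta>\<^sub>0 t] g(2) by auto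
  have Z_sub: "Z j \<subseteq> {x \<in> ?J. g x = 0}" for j by (auto simp: Z_def I_def)
  have Z_disj: "Z j \<inter> Z k = {}" if "j < k" "k < r" for j k
  proof -
    have "x < b j" if "x \<in> Z j" for x using that unfolding Z_def I_def less_le by blast
    moreover have "a k < x" if "x \<in> Z k" for x using that unfolding Z_def I_def less_le by blast
    ultimately show ?thesis using order[OF that] by fastforce
  qed
  have "(\<Sum>j<r. card (Z j)) = card (\<Union>j<r. Z j)"
    by (subst card_UN_disjoint) (use Z_disj finite_subset[OF Z_sub fin] in \<open>auto simp: linorder_neq_iff\<close>)
  also have "\<dots> \<le> card {x \<in> ?J. g x = 0}" using Z_sub by (intro card_mono fin) auto
  also have "\<dots> < (\<Sum>j<r. n j)" using card N by simp
  finally obtain j where j: "j < r" "card (Z j) < n j" by (meson lessThan_iff not_less sum_mono)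
  have cm: "circle_measure (\<mu> j)" using meas j(1) by blast
  have "\<exists>i<n j. (\<integral>\<theta>. half_angle_basis (n j) i \<theta> * ((cmod (cis \<theta> - \<zeta>))\<^sup>2 * g \<theta>) \<partial>angle_measure t (\<mu> j)) \<noteq> 0"
  proof (rule chebyshev_system_not_orthogonal[where J = ?J and I = "I j" and a = t and b = "t + 2 * pi"])
    show "finite_measure (angle_measure t (\<mu> j))" by (rule finite_angle_measure[OF cm])
    show "AE x in angle_measure t (\<mu> j). x \<in> ?J" by (rule AE_angle_measure_bounds[OF cm])
    show "\<not> (AE x in angle_measure t (\<mu> j). x \<in> F)" if "finite F" for F
      by (rule angle_measure_not_finite[OF cm that])
    \<comment> \<open>Only endpoints are removed, so what remains is still an interval.\<close>
    show "is_interval (I j)" unfolding is_interval_1 I_def by auto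
    show "I j \<subseteq> ?J" by (auto simp: I_def)
    show "AE x in angle_measure t (\<mu> j). x \<in> I j \<or> g x = 0"
      using arcs[OF j(1)] AE_angle_measure_bounds[OF cm, of t] by eventually_elim (auto simp: I_def)
    show "continuous_on UNIV (\<lambda>\<theta>. (cmod (cis \<theta> - \<zeta>))\<^sup>2)" by (intro continuous_intros continuous_on_cis)
    show "finite {x \<in> ?J. (cmod (cis x - \<zeta>))\<^sup>2 = 0}" by (rule finite_zeros_dist)
    show "continuous_on UNIV g" by (rule trig_poly_real_continuous[OF g(1)])
    show "finite {x \<in> ?J. g x = 0}" by (rule fin)
    show "card {x \<in> I j. g x = 0} < n j" using j(2) by (simp add: Z_def)
    show "continuous_on UNIV (half_angle_basis (n j) i)" if "i < n j" for i
      unfolding half_angle_basis_def by (intro continuous_intros) auto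
    show "det_fun (n j) (\<lambda>i k. half_angle_basis (n j) i (x k)) \<noteq> 0"
      if "strict_mono_on {..<n j} x" "x ` {..<n j} \<subseteq> I j" for x
      using strict_mono_on_imp_inj_on[OF that(1)] that(2) by (intro half_angle_basis_det[of _ _ t]) (auto simp: I_def)
  qed auto
  then obtain i where i: "i < n j"
    "(\<integral>\<theta>. half_angle_basis (n j) i \<theta> * ((cmod (cis \<theta> - \<zeta>))\<^sup>2 * g \<theta>) \<partial>angle_measure t (\<mu> j)) \<noteq> 0"
    by blast
  show ?thesis
    using j(1) i by (intro exI[of _ j] conjI exI[of _ "half_angle_basis (n j) i"] half_angle_basis_trig_poly) auto
qed

text \<open>Stated for arbitrary densities, because a weight of an AT system is controlled only on
  its arc and may be nonmeasurable elsewhere.\<close>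

lemma density_cong_AE:
  "(AE x in M. f x = g x) \<Longrightarrow> density M f = density M g"
  unfolding density_def by (intro arg_cong[where f="measure_of _ _"] ext nn_integral_cong_AE) (auto elim: eventually_mono)

text \<open>The multi-index with 1 at \<open>j\<close> and 0 elsewhere reduces the system to
  \<open>w j\<close> alone, with a determinant of size one.\<close>

lemma chebyshev_single:
  assumes cheb: "\<And>n. chebyshev_system \<alpha> \<beta> (concat (map (\<lambda>j. trig_list (n j) (w j)) [0..<r]))"
    and j: "j < r" and x: "x \<in> {\<alpha>..\<beta>}"
  shows "w j x \<noteq> 0"
proof -
  have "concat (map (\<lambda>l. trig_list (if l = j then 1 else 0) (w l)) [0..<s]) = (if j < s then [w j] else [])" for s
    by (induction s) (auto simp: trig_list_def)
  then have "chebyshev_system \<alpha> \<beta> [w j]"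
    using cheb[of "\<lambda>l. if l = j then 1 else 0"] j by simp
  then have "det_fun 1 (\<lambda>i k. ([w j] ! i) ([x] ! k)) \<noteq> 0"
    using x unfolding chebyshev_system_def by (auto dest!: spec[of _ "[x]"])
  from det_fun_1[OF this] show ?thesis by simp
qed

text \<open>All \<open>M + 1\<close> functions of the Chebyshev system are used at once, with the
  common measure \<open>\<mu>0\<close>; \<open>g\<close> has at most \<open>M\<close> zeros. The
  function that is not orthogonal to \<open>g\<close> is some \<open>w j\<close> times a test
  function, and \<open>w j\<close> is absorbed into \<open>\<mu> j\<close>.\<close>

lemma AT_no_orthogonal:
  assumes meas: "\<forall>j<r. circle_measure (\<mu> j)" and AT: "AT_system t r \<mu>"
    and N: "(\<Sum>j<r. n j) = Suc M" and g: "trig_poly M (\<lambda>\<theta>. complex_of_real (g \<theta>))" "g \<theta>\<^sub>0 \<noteq> 0"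
  shows "\<exists>j<r. 0 < n j \<and> (\<exists>\<tau>. trig_poly (n j - 1) (\<lambda>\<theta>. complex_of_real (\<tau> \<theta>)) \<and>
    (\<integral>\<theta>. \<tau> \<theta> * ((cmod (cis \<theta> - \<zeta>))\<^sup>2 * g \<theta>) \<partial>angle_measure t (\<mu> j)) \<noteq> 0)"
proof -
  let ?J = "{t..<t + 2 * pi}"
  from AT obtain \<alpha> \<beta> \<mu>0 w where "t = \<alpha>" "0 < \<beta> - \<alpha>" "\<beta> - \<alpha> \<le> 2 * pi"
    and \<mu>0: "circle_measure \<mu>0" "msupp \<mu>0 \<subseteq> arc \<alpha> \<beta>"
    and w_cont: "\<And>j. j < r \<Longrightarrow> continuous_on {\<alpha>..\<beta>} (w j)"
    and \<mu>: "\<And>j. j < r \<Longrightarrow> \<mu> j = density \<mu>0 (\<lambda>z. ennreal (w j (arg_from \<alpha> z)))"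
    and cheb: "\<And>n. chebyshev_system \<alpha> \<beta> (concat (map (\<lambda>j. trig_list (n j) (w j)) [0..<r]))"
    unfolding AT_system_def by blast
  then have \<beta>: "t < \<beta>" "\<beta> \<le> t + 2 * pi" by simp_all
  note \<mu>0 = \<mu>0[folded \<open>t = \<alpha>\<close>] and w_cont = w_cont[folded \<open>t = \<alpha>\<close>] and \<mu> = \<mu>[folded \<open>t = \<alpha>\<close>]
    and cheb = cheb[folded \<open>t = \<alpha>\<close>]
  have sets0: "sets \<mu>0 = sets borel" using \<mu>0 by (simp add: circle_measure_def)
  have arg_ae: "AE z in \<mu>0. arg_from t z \<in> {t..\<beta>}"
    using AE_msupp[OF sets0]
  proof eventually_elim
    case (elim z)
    then obtain x where x: "x \<in> {t..\<beta>}" "z = cis x" using \<mu>0(2) by (auto simp: Defs.arc_def)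
    show ?case
    proof (cases "x = t + 2 * pi")
      case True
      then have "z = cis t" using x by (simp add: complex_eq_iff)
      then show ?thesis using arg_from_cis[of t t] \<beta>(1) by simp
    next
      case False
      then have "x \<in> ?J" using x \<beta> by auto
      then show ?thesis using x arg_from_cis by simp
    qed
  qed
  \<comment> \<open>Nothing is known about \<open>w j\<close> outside \<open>{t..\<beta>}\<close>, not even measurability.\<close>
  define clamp where "clamp x = max t (min \<beta> x)" for x
  have clamp: "clamp x \<in> {t..\<beta>}" "x \<in> {t..\<beta>} \<Longrightarrow> clamp x = x" for x
    using \<beta>(1) by (auto simp: clamp_def)
  have clamp_cont: "continuous_on UNIV clamp" unfolding clamp_def by (intro continuous_intros)
  have w'_cont: "continuous_on UNIV (\<lambda>x. w j (clamp x))" if "j < r" for j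
    by (rule continuous_on_compose2[OF w_cont[OF that] clamp_cont]) (use clamp(1) in auto)
  have w'_meas: "(\<lambda>z. w j (clamp (arg_from t z))) \<in> borel_measurable \<mu>0" if "j < r" for j
    by (rule measurable_compose[OF arg_from_measurable_circle[OF \<mu>0(1)]
        borel_measurable_continuous_onI[OF w'_cont[OF that]]])
  have \<mu>': "\<mu> j = density \<mu>0 (\<lambda>z. ennreal (w j (clamp (arg_from t z))))" if j: "j < r" for j
    unfolding \<mu>[OF j]
  proof (rule density_cong_AE)
    show "AE z in \<mu>0. ennreal (w j (arg_from t z)) = ennreal (w j (clamp (arg_from t z)))"
      using arg_ae by eventually_elim (simp only: clamp(2))
  qed
  \<comment> \<open>The weights have no zeros and hence a fixed sign. A negative weight is truncated
    to 0 by \<open>ennreal\<close>, which would make \<open>\<mu> j\<close> the zero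
    measure.\<close>
  have w_pos: "w j x > 0" if j: "j < r" and x: "x \<in> {t..\<beta>}" for j x
  proof (rule ccontr)
    assume neg: "\<not> ?thesis"
    obtain s where s: "\<forall>x\<in>{t..\<beta>}. sgn (w j x) = s"
      using sgn_constant_on_interval[of "{t..\<beta>}" "w j"] is_interval_cc w_cont[OF j] chebyshev_single[OF cheb j]
      by blast
    have "w j x < 0" using neg chebyshev_single[OF cheb j x] by linarith
    then have "s = -1" using s x by (metis sgn_neg)
    then have le: "w j y \<le> 0" if "y \<in> {t..\<beta>}" for y
      using s[rule_format, OF that] by (simp add: sgn_if split: if_splits)
    have m: "(\<lambda>z. ennreal (w j (clamp (arg_from t z)))) \<in> borel_measurable \<mu>0"
      using w'_meas[OF j] by (rule measurable_compose[OF _ measurable_ennreal])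
    have "AE z in \<mu> j. z \<in> {}"
      unfolding \<mu>'[OF j] AE_density[OF m] by (rule AE_I2) (simp only: ennreal_neg[OF le[OF clamp(1)]], simp)
    then show False using circle_measure_not_finite[of "\<mu> j" "{}"] meas j by simp
  qed
  define us where "us = concat (map (\<lambda>j. trig_list (n j) (w j)) [0..<r])"
  have len: "length us = Suc M"
    unfolding us_def N[symmetric] by (simp add: length_concat o_def length_trig_list sum_list_distinct_conv_sum_set lessThan_atLeast0)
  have memb: "\<exists>j<r. 0 < n j \<and> (\<exists>\<tau>. trig_poly (n j - 1) (\<lambda>\<theta>. complex_of_real (\<tau> \<theta>)) \<and> us ! i = (\<lambda>\<theta>. w j \<theta> * \<tau> \<theta>))"
    if "i < Suc M" for i
  proof -
    have "us ! i \<in> set us" using that len by simp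
    then obtain j where "j < r" "us ! i \<in> set (trig_list (n j) (w j))" by (auto simp: us_def)
    then show ?thesis using trig_list_memb by blast
  qed
  have fin: "finite {x \<in> ?J. g x = 0}" and card: "card {x \<in> ?J. g x = 0} \<le> M"
    using trig_poly_zeros[OF g(1), of \<theta>\<^sub>0 t] g(2) by auto
  have h_cont: "continuous_on UNIV (\<lambda>\<theta>. (cmod (cis \<theta> - \<zeta>))\<^sup>2)" by (intro continuous_intros continuous_on_cis)
  have g_cont: "continuous_on UNIV g" by (rule trig_poly_real_continuous[OF g(1)])
  have ae0: "AE x in angle_measure t \<mu>0. x \<in> {t..\<beta>}"
    using arg_ae by (subst AE_angle_measure[OF \<mu>0(1)]) auto
  have "\<exists>i<Suc M. (\<integral>\<theta>. (us ! i) (clamp \<theta>) * ((cmod (cis \<theta> - \<zeta>))\<^sup>2 * g \<theta>) \<partial>angle_measure t \<mu>0) \<noteq> 0"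
  \<comment> \<open>The point \<open>t + 2 * pi\<close> is excluded even if \<open>\<beta>\<close>
    reaches it, because zeros are counted in a half-open period.\<close>
  proof (rule chebyshev_system_not_orthogonal[where J = ?J and I = "{t..\<beta>} \<inter> ?J" and a = t and b = "t + 2 * pi"])
    show "finite_measure (angle_measure t \<mu>0)" by (rule finite_angle_measure[OF \<mu>0(1)])
    show J: "AE x in angle_measure t \<mu>0. x \<in> ?J" by (rule AE_angle_measure_bounds[OF \<mu>0(1)])
    show "\<not> (AE x in angle_measure t \<mu>0. x \<in> F)" if "finite F" for F
      by (rule angle_measure_not_finite[OF \<mu>0(1) that])
    show "is_interval ({t..\<beta>} \<inter> ?J)" by (auto simp: is_interval_1)
    show "AE x in angle_measure t \<mu>0. x \<in> {t..\<beta>} \<inter> ?J \<or> g x = 0" using ae0 J by eventually_elim simp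
    show "finite {x \<in> ?J. (cmod (cis x - \<zeta>))\<^sup>2 = 0}" by (rule finite_zeros_dist)
    show "finite {x \<in> ?J. g x = 0}" by (rule fin)
    have "card {x \<in> {t..\<beta>} \<inter> ?J. g x = 0} \<le> card {x \<in> ?J. g x = 0}" by (intro card_mono fin) auto
    then show "card {x \<in> {t..\<beta>} \<inter> ?J. g x = 0} < Suc M" using card by simp
    show "continuous_on UNIV (\<lambda>\<theta>. (us ! i) (clamp \<theta>))" if i: "i < Suc M" for i
    proof -
      obtain j \<tau> where j: "j < r" "trig_poly (n j - 1) (\<lambda>\<theta>. complex_of_real (\<tau> \<theta>))" "us ! i = (\<lambda>\<theta>. w j \<theta> * \<tau> \<theta>)"
        using memb[OF i] by blast
      show ?thesis unfolding j(3)
        by (intro continuous_on_mult w'_cont j(1) continuous_on_compose2[OF trig_poly_real_continuous[OF j(2)] clamp_cont]) simp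
    qed
    show "det_fun (Suc M) (\<lambda>i k. (us ! i) (clamp (x k))) \<noteq> 0"
      if x: "strict_mono_on {..<Suc M} x" "x ` {..<Suc M} \<subseteq> {t..\<beta>} \<inter> ?J" for x
    proof -
      define xs where "xs = map x [0..<Suc M]"
      have "length xs = length us" "distinct xs" "set xs \<subseteq> {t..\<beta>}"
        using strict_mono_on_imp_inj_on[OF x(1)] x(2)
        by (auto simp: xs_def len distinct_map lessThan_atLeast0 simp del: upt_Suc)
      then have "det_fun (Suc M) (\<lambda>i k. (us ! i) (xs ! k)) \<noteq> 0"
        using cheb[of n] unfolding chebyshev_system_def us_def[symmetric] len by auto
      moreover have "det_fun (Suc M) (\<lambda>i k. (us ! i) (xs ! k)) = det_fun (Suc M) (\<lambda>i k. (us ! i) (clamp (x k)))"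
      proof (rule det_fun_cong)
        fix i k assume "k < Suc M"
        moreover from this have "x k \<in> {t..\<beta>}" using x(2) by auto
        ultimately show "(us ! i) (xs ! k) = (us ! i) (clamp (x k))" by (simp add: xs_def clamp(2) del: upt_Suc)
      qed
      ultimately show ?thesis by simp
    qed
  qed (use h_cont g_cont in auto)
  then obtain i where i: "i < Suc M"
    "(\<integral>\<theta>. (us ! i) (clamp \<theta>) * ((cmod (cis \<theta> - \<zeta>))\<^sup>2 * g \<theta>) \<partial>angle_measure t \<mu>0) \<noteq> 0" by blast
  obtain j \<tau> where j: "j < r" "0 < n j" "trig_poly (n j - 1) (\<lambda>\<theta>. complex_of_real (\<tau> \<theta>))" "us ! i = (\<lambda>\<theta>. w j \<theta> * \<tau> \<theta>)"
    using memb[OF i(1)] by blast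
  define f where "f \<theta> = \<tau> \<theta> * ((cmod (cis \<theta> - \<zeta>))\<^sup>2 * g \<theta>)" for \<theta>
  have f_cont: "continuous_on UNIV f"
    unfolding f_def by (intro continuous_on_mult h_cont g_cont trig_poly_real_continuous[OF j(3)])
  have f_meas: "f \<in> borel_measurable borel" by (rule borel_measurable_continuous_onI[OF f_cont])
  have cm: "circle_measure (\<mu> j)" using meas j(1) by blast
  \<comment> \<open>The integral goes back to the circle, where \<open>\<mu> j\<close> has its
    density, and then returns to the angles of \<open>\<mu>0\<close>.\<close>
  have "(\<integral>\<theta>. f \<theta> \<partial>angle_measure t (\<mu> j)) = (\<integral>z. f (arg_from t z) \<partial>\<mu> j)"
    by (rule integral_distr[OF arg_from_measurable_circle[OF cm] f_meas])
  also have "\<dots> = (\<integral>z. w j (clamp (arg_from t z)) * f (arg_from t z) \<partial>\<mu>0)"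
    unfolding \<mu>'[OF j(1)] using w'_meas[OF j(1)] w_pos[OF j(1) clamp(1)]
      measurable_compose[OF arg_from_measurable_circle[OF \<mu>0(1)] f_meas]
    by (subst integral_density) (auto simp: less_imp_le)
  also have "\<dots> = (\<integral>\<theta>. w j (clamp \<theta>) * f \<theta> \<partial>angle_measure t \<mu>0)"
    by (rule integral_distr[OF arg_from_measurable_circle[OF \<mu>0(1)], symmetric])
      (intro borel_measurable_continuous_onI continuous_on_mult w'_cont j(1) f_cont)
  also have "\<dots> = (\<integral>\<theta>. (us ! i) (clamp \<theta>) * ((cmod (cis \<theta> - \<zeta>))\<^sup>2 * g \<theta>) \<partial>angle_measure t \<mu>0)"
  proof (rule Bochner_Integration.integral_cong_AE)
    show "(\<lambda>\<theta>. w j (clamp \<theta>) * f \<theta>) \<in> borel_measurable (angle_measure t \<mu>0)"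
      using borel_measurable_continuous_onI[OF continuous_on_mult[OF w'_cont[OF j(1)] f_cont]] by simp
    have "continuous_on UNIV (\<lambda>\<theta>. w j (clamp \<theta>) * \<tau> (clamp \<theta>) * ((cmod (cis \<theta> - \<zeta>))\<^sup>2 * g \<theta>))"
      by (intro continuous_on_mult w'_cont j(1) h_cont g_cont
          continuous_on_compose2[OF trig_poly_real_continuous[OF j(3)] clamp_cont]) simp
    from borel_measurable_continuous_onI[OF this]
    show "(\<lambda>\<theta>. (us ! i) (clamp \<theta>) * ((cmod (cis \<theta> - \<zeta>))\<^sup>2 * g \<theta>)) \<in> borel_measurable (angle_measure t \<mu>0)"
      unfolding j(4) by simp
    show "AE x in angle_measure t \<mu>0. w j (clamp x) * f x = (us ! i) (clamp x) * ((cmod (cis x - \<zeta>))\<^sup>2 * g x)"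
      using ae0 by eventually_elim (simp add: j(4) f_def clamp(2))
  qed
  finally show ?thesis using i(2) j unfolding f_def by (intro exI[of _ j]) auto
qed

theorem theorem5p1:
  fixes t0 :: real and r :: nat and \<mu> :: "nat \<Rightarrow> complex measure"
    and n :: "nat \<Rightarrow> nat" and c :: "nat \<Rightarrow> complex"
  assumes meas: "\<forall>j<r. circle_measure (\<mu> j)"
    and sys: "angelesco t0 r \<mu> \<or> AT_system t0 r \<mu>"
    and monic: "c (\<Sum>j<r. n j) = 1"
    and orth: "phi_orth t0 r \<mu> n c"
  shows "\<forall>z::complex. (\<Sum>m\<le>(\<Sum>j<r. n j). c m * z ^ m) = 0 \<longrightarrow> cmod z < 1"
proof (intro allI impI, rule ccontr)
  fix z0 :: complex
  assume root: "(\<Sum>m\<le>(\<Sum>j<r. n j). c m * z0 ^ m) = 0" and "\<not> cmod z0 < 1"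
  then have z0: "1 \<le> cmod z0" by simp
  \<comment> \<open>For total degree 0 the polynomial is the constant 1, which has no zero.\<close>
  obtain M where M: "(\<Sum>j<r. n j) = Suc M"
    using root monic by (cases "\<Sum>j<r. n j") auto
  define \<Phi> where "\<Phi> = (\<Sum>k\<le>Suc M. monom (c k) k)"
  have poly: "poly \<Phi> z = (\<Sum>k\<le>Suc M. c k * z ^ k)" for z
    by (simp add: \<Phi>_def poly_sum poly_monom)
  have coeff: "coeff \<Phi> k = (if k \<le> Suc M then c k else 0)" for k
    by (auto simp: \<Phi>_def coeff_sum)
  have deg: "degree \<Phi> = Suc M"
  proof (rule antisym)
    show "degree \<Phi> \<le> Suc M" by (rule degree_le) (simp add: coeff)
    show "Suc M \<le> degree \<Phi>" by (rule le_degree) (use monic M in \<open>simp add: coeff\<close>)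
  qed
  then have "lead_coeff \<Phi> = 1" using monic M by (simp add: coeff)
  moreover have "poly \<Phi> z0 = 0" using root unfolding poly M .
  ultimately obtain l \<zeta> g where g: "trig_poly M (\<lambda>\<theta>. complex_of_real (g \<theta>))" "\<exists>\<theta>. g \<theta> \<noteq> 0"
    "\<And>\<theta>. Re (l * (cis (- (real M * \<theta> / 2)) * poly \<Phi> (cis \<theta>))) = (cmod (cis \<theta> - \<zeta>))\<^sup>2 * g \<theta>"
    using real_part_factorization[OF _ _ z0 deg] by metis
  obtain \<theta>\<^sub>0 where \<theta>\<^sub>0: "g \<theta>\<^sub>0 \<noteq> 0" using g(2) by blast
  \<comment> \<open>This test function is not orthogonal to the weighted \<open>g\<close>, whereas
    the relations in \<open>orth\<close> force its integral to vanish.\<close>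
  obtain j \<tau> where j: "j < r" "0 < n j" "trig_poly (n j - 1) (\<lambda>\<theta>. complex_of_real (\<tau> \<theta>))"
    and nonzero: "(\<integral>\<theta>. \<tau> \<theta> * ((cmod (cis \<theta> - \<zeta>))\<^sup>2 * g \<theta>) \<partial>angle_measure t0 (\<mu> j)) \<noteq> 0"
    using sys angelesco_no_orthogonal[OF meas _ M g(1) \<theta>\<^sub>0, of t0 \<zeta>] AT_no_orthogonal[OF meas _ M g(1) \<theta>\<^sub>0, of t0 \<zeta>]
    by blast
  have "(\<integral>z. phi_fun t0 (Suc M) c z * hpow t0 (- (2 * int i - int (n j))) z \<partial>\<mu> j) = 0" if "i < n j" for i
    using orth that j(1) unfolding phi_orth_def M by blast
  then have "(\<integral>\<theta>. \<tau> \<theta> * ((cmod (cis \<theta> - \<zeta>))\<^sup>2 * g \<theta>) \<partial>angle_measure t0 (\<mu> j)) = 0"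
    using orth_real_trig_poly[of "\<mu> j" "n j" t0 M c \<tau> l "\<lambda>\<theta>. (cmod (cis \<theta> - \<zeta>))\<^sup>2 * g \<theta>"] meas j g(3)
    unfolding poly by blast
  then show False using nonzero by contradiction
qed

end
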